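(* Fix a positive integer $n$. If the ideal of $2\times 2$ minors of a generic $(n+2)\times n$ matrix is of fiber type, then for every $m\ge n$ the ideal of $2\times 2$ minors of a generic $m\times n$ matrix is of fiber type.
   Context: A generic $m\times n$ matrix is the matrix of indeterminates $(x_{i,j})$ over $\mathbb{C}$. Let $S=\mathbb{C}[x_{i,j}]$ be the polynomial ring in its entries (standard graded), $W\subset S_2$ the span of its $2\times 2$ minors, $I_2=\langle W\rangle\subseteq S$, and $R=\operatorname{Sym}(W)$, graded so that $W$ is placed in degree $2$. The Rees algebra is $\operatorname{Rees}(I_2)=\bigoplus_{d\ge0}I_2^d\cong S[I_2t]\subseteq S[t]$. Let $\Pi:S\otimes_{\mathbb{C}}R\to S[t]$ be the $S$-algebra map sending each generator $w\in W$ of $R$ to $wt$; its image is $\operatorname{Rees}(I_2)$. Let $\mathcal{J}=\ker\Pi$, bi-graded by the bi-degree of $S\otimes R$ (so $V_1\otimes V_2=S_1$ has bi-degree $(1,0)$ and $W\subset R$ has bi-degree $(0,2)$). The ideal $I_2$ is said to be of fiber type if the ideal $\mathcal{J}$ is generated by its bi-graded components $\mathcal{J}_{(0,2d)}$ and $\mathcal{J}_{(d,2)}$, $d\in\mathbb{N}$. *)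

theory Defs
  imports
    Complex_Main
    "HOL-Library.Poly_Mapping"
    "HOL-Computational_Algebra.Polynomial"
    "HOL-Algebra.Ideal"
begin


section \<open>Polynomial rings over the complex numbers\<close>

text \<open>A polynomial is a finitely supported function from monomials (exponent vectors) to
  coefficients. The rings with different sets of indeterminates are the subrings
  \<open>poly_ring V\<close> of this type.\<close>

type_synonym 'v mon = "'v \<Rightarrow>\<^sub>0 nat"
type_synonym 'v cpoly = "'v mon \<Rightarrow>\<^sub>0 complex"

definition const :: "complex \<Rightarrow> 'v cpoly"
  where "const c = Poly_Mapping.single 0 c"

definition var :: "'v \<Rightarrow> 'v cpoly"
  where "var v = Poly_Mapping.single (Poly_Mapping.single v 1) 1"

definition indets :: "'v cpoly \<Rightarrow> 'v set"
  where "indets p = (\<Union>\<mu>\<in>Poly_Mapping.keys p. Poly_Mapping.keys \<mu>)"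

definition poly_ring :: "'v set \<Rightarrow> 'v cpoly ring"
  where "poly_ring V =
    \<lparr>carrier = {p. indets p \<subseteq> V}, monoid.mult = (*), one = 1, zero = 0, add = (+)\<rparr>"

interpretation cpoly: vector_space "\<lambda>c (p :: 'v cpoly). const c * p"
  by unfold_locales
    (simp_all add: const_def algebra_simps single_add mult_single flip: mult.assoc)

lemma indets_add: "indets (p + q) \<subseteq> indets p \<union> indets q"
  using Poly_Mapping.keys_add[of p q] unfolding indets_def by blast

lemma indets_uminus: "indets (- p) = indets p"
  unfolding indets_def by (simp add: Poly_Mapping.keys.rep_eq)

lemma indets_mult: "indets (p * q) \<subseteq> indets p \<union> indets q"
proof
  fix v assume "v \<in> indets (p * q)"
  then obtain \<mu> where "\<mu> \<in> Poly_Mapping.keys (p * q)" "v \<in> Poly_Mapping.keys \<mu>"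
    unfolding indets_def by blast
  then obtain a b where "\<mu> = a + b" "a \<in> Poly_Mapping.keys p" "b \<in> Poly_Mapping.keys q"
    using keys_mult[of p q] by blast
  then show "v \<in> indets p \<union> indets q"
    using \<open>v \<in> Poly_Mapping.keys \<mu>\<close> Poly_Mapping.keys_add[of a b] unfolding indets_def by blast
qed

lemma indets_0_1: "indets 0 = {}" "indets 1 = {}"
  by (simp_all add: indets_def)

lemma cring_poly_ring: "cring (poly_ring V)"
proof (rule cringI)
  show "abelian_group (poly_ring V)"
  proof (rule abelian_groupI)
    fix x assume "x \<in> carrier (poly_ring V)"
    then show "\<exists>y\<in>carrier (poly_ring V). y \<oplus>\<^bsub>poly_ring V\<^esub> x = \<zero>\<^bsub>poly_ring V\<^esub>"
      by (intro bexI[of _ "- x"]) (simp_all add: poly_ring_def indets_uminus)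
  next
    fix x y assume "x \<in> carrier (poly_ring V)" "y \<in> carrier (poly_ring V)"
    then show "x \<oplus>\<^bsub>poly_ring V\<^esub> y \<in> carrier (poly_ring V)"
      using indets_add[of x y] unfolding poly_ring_def by auto
  qed (simp_all add: poly_ring_def indets_0_1 ac_simps)
  show "Group.comm_monoid (poly_ring V)"
  proof (rule comm_monoidI)
    fix x y assume "x \<in> carrier (poly_ring V)" "y \<in> carrier (poly_ring V)"
    then show "x \<otimes>\<^bsub>poly_ring V\<^esub> y \<in> carrier (poly_ring V)"
      using indets_mult[of x y] unfolding poly_ring_def by auto
  qed (simp_all add: poly_ring_def indets_0_1 ac_simps)
qed (simp add: poly_ring_def distrib_right)


section \<open>The two by two minors of a generic matrix\<close>

text \<open>Rows and columns are numbered from 0, and \<open>var (i, j)\<close> is the entry in row \<open>i\<close> and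
  column \<open>j\<close>. The index \<open>((i, i'), (j, j'))\<close> stands for the minor with rows \<open>i < i'\<close> and
  columns \<open>j < j'\<close>.\<close>

type_synonym entry = "nat \<times> nat"
type_synonym minor_index = "(nat \<times> nat) \<times> (nat \<times> nat)"

definition entries :: "nat \<Rightarrow> nat \<Rightarrow> entry set"
  where "entries m n = {..<m} \<times> {..<n}"

definition minor_indices :: "nat \<Rightarrow> nat \<Rightarrow> minor_index set"
  where "minor_indices m n = {((i, i'), (j, j')). i < i' \<and> i' < m \<and> j < j' \<and> j' < n}"

fun minor :: "minor_index \<Rightarrow> entry cpoly"
  where "minor ((i, i'), (j, j')) =
    var (i, j) * var (i', j') - var (i, j') * var (i', j)"

definition minor_space :: "nat \<Rightarrow> nat \<Rightarrow> entry cpoly set"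
  where "minor_space m n = cpoly.span (minor ` minor_indices m n)"

fun diag_mon :: "minor_index \<Rightarrow> entry mon"
  where "diag_mon ((i, i'), (j, j')) =
    Poly_Mapping.single (i, j) 1 + Poly_Mapping.single (i', j') 1"

lemma pair_mon_eq_iff:
  "Poly_Mapping.single a 1 + Poly_Mapping.single b 1 =
     (Poly_Mapping.single c 1 + Poly_Mapping.single d 1 :: 'v mon)
   \<longleftrightarrow> (a = c \<and> b = d) \<or> (a = d \<and> b = c)" (is "?L \<longleftrightarrow> ?R")
proof
  assume ?L
  then have *: "Poly_Mapping.lookup (Poly_Mapping.single a 1 + Poly_Mapping.single b (1::nat)) x =
      Poly_Mapping.lookup (Poly_Mapping.single c 1 + Poly_Mapping.single d 1) x" for x
    by simp
  show ?R
    using *[of a] *[of b] *[of c] *[of d]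
    by (auto simp: lookup_add lookup_single when_def split: if_splits)
qed (auto simp: add.commute)

lemma lookup_minor_diag:
  assumes "q \<in> minor_indices m n" "r \<in> minor_indices m n"
  shows "Poly_Mapping.lookup (minor q) (diag_mon r) = (if q = r then 1 else 0)"
proof -
  obtain i i' j j' k k' l l' where "q = ((i, i'), (j, j'))" "r = ((k, k'), (l, l'))"
    by (metis surj_pair)
  with assms show ?thesis
    by (auto simp: minor_indices_def var_def mult_single lookup_minus lookup_single when_def
        pair_mon_eq_iff simp del: One_nat_def)
qed

text \<open>The minors form a basis of \<open>W = minor_space m n\<close>, so \<open>R = Sym(W)\<close> is the polynomial
  ring with one indeterminate for each minor.\<close>

lemma inj_on_minor: "inj_on minor (minor_indices m n)"
  by (rule inj_onI) (metis lookup_minor_diag zero_neq_one)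

lemma independent_minors: "cpoly.independent (minor ` minor_indices m n)"
proof -
  have "u v = 0" if t: "finite t" "t \<subseteq> minor ` minor_indices m n"
    and 0: "(\<Sum>w\<in>t. const (u w) * w) = 0" and v: "v \<in> t" for t u v
  proof -
    obtain r where r: "r \<in> minor_indices m n" "v = minor r" using t v by blast
    have l: "Poly_Mapping.lookup w (diag_mon r) = (if w = v then 1 else 0)" if "w \<in> t" for w
    proof -
      obtain q where q: "q \<in> minor_indices m n" "w = minor q" using \<open>w \<in> t\<close> t(2) by blast
      have "w = v \<longleftrightarrow> q = r"
        unfolding q(2) r(2) by (rule inj_on_eq_iff[OF inj_on_minor q(1) r(1)])
      then show ?thesis
        unfolding q(2) lookup_minor_diag[OF q(1) r(1)] by simp
    qed
    have c: "Poly_Mapping.lookup (const c * w) (diag_mon r) = c * Poly_Mapping.lookup w (diag_mon r)"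
      for c and w :: "entry cpoly"
      unfolding const_def mult_map_scale_conv_mult[symmetric]
      by (simp add: Poly_Mapping.map.rep_eq when_def)
    have "0 = Poly_Mapping.lookup (\<Sum>w\<in>t. const (u w) * w) (diag_mon r)"
      unfolding 0 by simp
    also have "\<dots> = (\<Sum>w\<in>t. Poly_Mapping.lookup (const (u w) * w) (diag_mon r))"
      by (rule lookup_sum)
    also have "\<dots> = (\<Sum>w\<in>t. if w = v then u w else 0)"
      by (intro sum.cong refl) (simp only: c l, simp)
    also have "\<dots> = u v" using t v by simp
    finally show ?thesis by simp
  qed
  then show ?thesis unfolding cpoly.independent_explicit_module by blast
qed


section \<open>The presentation of the Rees algebra\<close>

text \<open>The tensor product over the complex numbers of \<open>S\<close> and \<open>R = Sym(W)\<close> is the polynomial ring in the disjoint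
  union of the entries \<open>Inl e\<close>, which generate \<open>S\<close>, and the minor indices \<open>Inr q\<close>, which are
  the basis of \<open>W\<close> inside \<open>R\<close>.\<close>

type_synonym sr_var = "entry + minor_index"

definition S_tensor_R :: "nat \<Rightarrow> nat \<Rightarrow> sr_var cpoly ring"
  where "S_tensor_R m n = poly_ring (Inl ` entries m n \<union> Inr ` minor_indices m n)"

text \<open>The \<open>S\<close>-algebra map to \<open>S[t]\<close>, with \<open>minor q\<close> in \<open>R\<close> going to \<open>minor q \<cdot> t\<close>. Here
  \<open>S[t]\<close> consists of the univariate polynomials over \<open>entry cpoly\<close>.\<close>

fun rees_var :: "sr_var \<Rightarrow> entry cpoly poly"
  where
    "rees_var (Inl e) = [: var e :]"
  | "rees_var (Inr q) = [: 0, minor q :]"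

definition rees_mon :: "sr_var mon \<Rightarrow> entry cpoly poly"
  where "rees_mon \<mu> = (\<Prod>v\<in>Poly_Mapping.keys \<mu>. rees_var v ^ Poly_Mapping.lookup \<mu> v)"

definition rees_map :: "sr_var cpoly \<Rightarrow> entry cpoly poly"
  where "rees_map p =
    (\<Sum>\<mu>\<in>Poly_Mapping.keys p. smult (const (Poly_Mapping.lookup p \<mu>)) (rees_mon \<mu>))"

definition rees_ideal :: "nat \<Rightarrow> nat \<Rightarrow> sr_var cpoly set"
  where "rees_ideal m n = {p \<in> carrier (S_tensor_R m n). rees_map p = 0}"

lemma rees_mon_superset:
  assumes "finite A" "Poly_Mapping.keys \<mu> \<subseteq> A"
  shows "rees_mon \<mu> = (\<Prod>v\<in>A. rees_var v ^ Poly_Mapping.lookup \<mu> v)"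
  unfolding rees_mon_def using assms
  by (intro prod.mono_neutral_left) (auto simp: in_keys_iff)

lemma rees_mon_0: "rees_mon 0 = 1"
  by (simp add: rees_mon_def)

lemma rees_mon_add: "rees_mon (\<mu> + \<nu>) = rees_mon \<mu> * rees_mon \<nu>"
proof -
  let ?A = "Poly_Mapping.keys \<mu> \<union> Poly_Mapping.keys \<nu>"
  have "rees_mon (\<mu> + \<nu>) = (\<Prod>v\<in>?A. rees_var v ^ Poly_Mapping.lookup (\<mu> + \<nu>) v)"
    by (intro rees_mon_superset Poly_Mapping.keys_add) auto
  also have "\<dots> = (\<Prod>v\<in>?A. rees_var v ^ Poly_Mapping.lookup \<mu> v) *
      (\<Prod>v\<in>?A. rees_var v ^ Poly_Mapping.lookup \<nu> v)"
    by (simp add: lookup_add power_add prod.distrib)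
  also have "\<dots> = rees_mon \<mu> * rees_mon \<nu>"
    by (simp add: rees_mon_superset[of ?A])
  finally show ?thesis .
qed

lemma rees_map_superset:
  assumes "finite A" "Poly_Mapping.keys p \<subseteq> A"
  shows "rees_map p = (\<Sum>\<mu>\<in>A. smult (const (Poly_Mapping.lookup p \<mu>)) (rees_mon \<mu>))"
  unfolding rees_map_def using assms
  by (intro sum.mono_neutral_left) (auto simp: in_keys_iff const_def)

lemma rees_map_add: "rees_map (p + q) = rees_map p + rees_map q"
proof -
  let ?A = "Poly_Mapping.keys p \<union> Poly_Mapping.keys q"
  have "rees_map (p + q) =
      (\<Sum>\<mu>\<in>?A. smult (const (Poly_Mapping.lookup (p + q) \<mu>)) (rees_mon \<mu>))"
    by (intro rees_map_superset Poly_Mapping.keys_add) auto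
  then show ?thesis
    by (simp add: rees_map_superset[of ?A] lookup_add const_def single_add smult_add_left
        sum.distrib)
qed

lemma rees_map_single: "rees_map (Poly_Mapping.single \<mu> c) = smult (const c) (rees_mon \<mu>)"
  by (subst rees_map_superset[of "{\<mu>}"]) auto

lemma rees_map_const: "rees_map (const c) = [: const c :]"
  by (simp add: const_def rees_map_single[unfolded const_def] rees_mon_0)

lemma rees_map_var: "rees_map (var v) = rees_var v"
  by (simp add: var_def rees_map_single rees_mon_def const_def)

lemma cpoly_induct [case_names single add]:
  assumes "\<And>\<mu> c. P (Poly_Mapping.single \<mu> c)" "\<And>p q. P p \<Longrightarrow> P q \<Longrightarrow> P (p + q)"
  shows "P (p :: 'v cpoly)"
proof (induction p rule: update_induct)
  case const
  show ?case using assms(1)[of 0 0] by simp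
next
  case (update f a b)
  have "Poly_Mapping.update a b f = f + Poly_Mapping.single a b"
    using update by (intro poly_mapping_eqI)
      (auto simp: lookup_update lookup_add lookup_single when_def in_keys_iff)
  then show ?case using update assms by simp
qed

lemma rees_map_mult: "rees_map (p * q) = rees_map p * rees_map q"
proof (induction p rule: cpoly_induct)
  case (single \<mu> c)
  show ?case
  proof (induction q rule: cpoly_induct)
    case (single \<nu> d)
    have "const (c * d) = const c * (const d :: entry cpoly)"
      by (simp add: const_def mult_single)
    then show ?case
      by (simp add: mult_single rees_map_single rees_mon_add mult_ac)
  qed (simp add: distrib_left rees_map_add)
qed (simp add: distrib_right rees_map_add)

lemma ideal_rees_ideal: "ideal (rees_ideal m n) (S_tensor_R m n)"
proof -
  interpret cring "S_tensor_R m n"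
    unfolding S_tensor_R_def by (rule cring_poly_ring)
  have ops: "x \<otimes>\<^bsub>S_tensor_R m n\<^esub> y = x * y" "x \<oplus>\<^bsub>S_tensor_R m n\<^esub> y = x + y"
    "\<zero>\<^bsub>S_tensor_R m n\<^esub> = 0" for x y
    by (simp_all add: S_tensor_R_def poly_ring_def)
  show ?thesis
  proof (rule idealI)
    show "subgroup (rees_ideal m n) (add_monoid (S_tensor_R m n))"
    proof (rule group.subgroupI)
      show "Group.group (add_monoid (S_tensor_R m n))"
        by (rule a_group)
      show "rees_ideal m n \<noteq> {}"
        using zero_closed by (auto simp: rees_ideal_def ops rees_map_def intro!: exI[of _ 0])
      fix a b assume a: "a \<in> rees_ideal m n"
      have "rees_map (\<ominus>\<^bsub>S_tensor_R m n\<^esub> a) = 0"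
        using a l_neg[of a] rees_map_add[of "\<ominus>\<^bsub>S_tensor_R m n\<^esub> a" a]
        by (simp add: rees_ideal_def ops rees_map_def[of 0])
      then have "\<ominus>\<^bsub>S_tensor_R m n\<^esub> a \<in> rees_ideal m n"
        using a by (simp add: rees_ideal_def)
      then show "inv\<^bsub>add_monoid (S_tensor_R m n)\<^esub> a \<in> rees_ideal m n"
        unfolding a_inv_def .
      assume "b \<in> rees_ideal m n"
      then show "a \<otimes>\<^bsub>add_monoid (S_tensor_R m n)\<^esub> b \<in> rees_ideal m n"
        using a add.m_closed[of a b] by (simp add: rees_ideal_def rees_map_add ops)
    qed (auto simp: rees_ideal_def)
  next
    fix a x assume ax: "a \<in> rees_ideal m n" "x \<in> carrier (S_tensor_R m n)"
    then show "x \<otimes>\<^bsub>S_tensor_R m n\<^esub> a \<in> rees_ideal m n" "a \<otimes>\<^bsub>S_tensor_R m n\<^esub> x \<in> rees_ideal m n"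
      using m_closed[of x a] m_closed[of a x]
      by (auto simp: rees_ideal_def rees_map_mult ops)
  qed (rule ring_axioms)
qed


section \<open>Fiber type\<close>

text \<open>An entry has bi-degree \<open>(1, 0)\<close>, and an indeterminate for a minor has bi-degree
  \<open>(0, 2)\<close>.\<close>

definition bidegree :: "sr_var mon \<Rightarrow> nat \<times> nat"
  where "bidegree \<mu> =
    (\<Sum>e\<in>{e. Inl e \<in> Poly_Mapping.keys \<mu>}. Poly_Mapping.lookup \<mu> (Inl e),
     \<Sum>q\<in>{q. Inr q \<in> Poly_Mapping.keys \<mu>}. 2 * Poly_Mapping.lookup \<mu> (Inr q))"

definition rees_ideal_component :: "nat \<Rightarrow> nat \<Rightarrow> nat \<times> nat \<Rightarrow> sr_var cpoly set"
  where "rees_ideal_component m n ab =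
    {p \<in> rees_ideal m n. \<forall>\<mu>\<in>Poly_Mapping.keys p. bidegree \<mu> = ab}"

definition minors_ideal_fiber_type :: "nat \<Rightarrow> nat \<Rightarrow> bool"
  where "minors_ideal_fiber_type m n \<longleftrightarrow>
    rees_ideal m n =
      Idl\<^bsub>S_tensor_R m n\<^esub>
        ((\<Union>d. rees_ideal_component m n (0, 2 * d)) \<union> (\<Union>d. rees_ideal_component m n (d, 2)))"

end

theory Submission
  imports Defs "HOL-Combinatorics.Permutations"
begin

text \<open>
  A relation is a polynomial in \<open>S \<otimes> R\<close> that \<open>\<Pi>\<close> kills. The Lie algebra of all row operations acts by
  derivations on \<open>S \<otimes> R\<close> and on \<open>S\<close>, compatibly with \<open>\<Pi>\<close>, and so preserves the relations and the
  ideal generated by those of bi-degree \<open>(0, 2d)\<close> and \<open>(d, 2)\<close>. A relation is shown to lie in this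
  ideal by induction on its degree \<open>d\<close> in the entries, and for each \<open>d\<close> by induction on the number
  \<open>m\<close> of rows that it involves, the case \<open>m = n + 2\<close> being the hypothesis.

  A polynomial that is linear and alternating in \<open>n + 1\<close> rows is a relation, since each monomial of
  its image in \<open>S[t]\<close> contains two entries of these rows in the same one of the \<open>n\<close> columns. So a
  polynomial of degree \<open>d + 1\<close> in the entries that is linear and alternating in \<open>n + 2\<close> rows is a
  combination of products of an entry with a relation of degree \<open>d\<close>: split off one entry from each
  monomial. By induction on \<open>d\<close> it lies in the ideal.

  The Capelli operator polarizes a relation \<open>f\<close> once in each of its \<open>m\<close> rows, alternates, and
  restitutes, so it maps \<open>f\<close> into the ideal. If \<open>f\<close> has degree \<open>a i\<close> in row \<open>i\<close>, and if all
  relations of higher weight already lie in the ideal, the operator multiplies \<open>f\<close> by the product of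
  the numbers \<open>a i + (m - 1 - i)\<close>, up to the ideal. This product is nonzero unless the last row is
  absent from \<open>f\<close>.
\<close>

section \<open>Polynomials\<close>

abbreviation pmon :: "'v mon \<Rightarrow> 'v cpoly"
  where "pmon \<mu> \<equiv> Poly_Mapping.single \<mu> 1"

definition sng :: "'v \<Rightarrow> 'v mon"
  where "sng v = Poly_Mapping.single v 1"

lemma lookup_sng: "Poly_Mapping.lookup (sng v) u = (1 when v = u)"
  by (simp add: sng_def lookup_single)

lemma keys_sng [simp]: "Poly_Mapping.keys (sng v) = {v}"
  by (simp add: sng_def)

lemma var_eq_pmon: "var v = pmon (sng v)"
  by (simp add: var_def sng_def)

lemma const_0 [simp]: "const 0 = 0"
  and const_1 [simp]: "const 1 = 1"
  by (simp_all add: const_def)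

lemma const_add: "const (c + d) = const c + const d"
  and const_mult: "const (c * d) = const c * const d"
  by (simp_all add: const_def single_add mult_single)

lemma const_mult_pmon: "const c * pmon \<mu> = Poly_Mapping.single \<mu> c"
  by (simp add: const_def mult_single)

lemma lookup_const_mult: "Poly_Mapping.lookup (const c * p) \<mu> = c * Poly_Mapping.lookup p \<mu>"
  unfolding const_def mult_map_scale_conv_mult[symmetric]
  by (simp add: Poly_Mapping.map.rep_eq when_def)

lemma var_mult_pmon: "var v * pmon \<mu> = pmon (sng v + \<mu>)"
  by (simp add: var_eq_pmon mult_single)

lemma keys_var [simp]: "Poly_Mapping.keys (var v) = {sng v}"
  by (simp add: var_eq_pmon)

lemma cpoly_eq_sum: "p = (\<Sum>\<mu>\<in>Poly_Mapping.keys p. const (Poly_Mapping.lookup p \<mu>) * pmon \<mu>)"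
  by (rule poly_mapping_eqI)
    (auto simp: lookup_sum const_mult_pmon lookup_single when_def in_keys_iff)

lemma cpoly_eq_neg_imp_zero:
  fixes p :: "'v cpoly"
  assumes "p = - p"
  shows "p = 0"
proof (rule poly_mapping_eqI)
  fix \<mu>
  have "Poly_Mapping.lookup p \<mu> = - Poly_Mapping.lookup p \<mu>"
    using assms by (metis lookup_uminus)
  then show "Poly_Mapping.lookup p \<mu> = Poly_Mapping.lookup 0 \<mu>" by simp
qed

lemma mon_induct [case_names zero sng_add]:
  assumes "P 0" and "\<And>v \<mu>. P \<mu> \<Longrightarrow> P (sng v + \<mu>)"
  shows "P (\<mu> :: 'v mon)"
proof (induction \<mu> rule: update_induct)
  case const
  show ?case by (rule assms(1))
next
  case (update f a b)
  have "P (Poly_Mapping.single a k + f)" for k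
  proof (induction k)
    case 0
    show ?case using update by simp
  next
    case (Suc k)
    have "Poly_Mapping.single a (Suc k) = sng a + Poly_Mapping.single a k"
      by (simp add: sng_def flip: single_add)
    then show ?case using assms(2)[OF Suc] by (simp add: add.assoc)
  qed
  moreover have "Poly_Mapping.update a b f = Poly_Mapping.single a b + f"
    using update by (intro poly_mapping_eqI)
      (auto simp: lookup_update lookup_add lookup_single when_def in_keys_iff)
  ultimately show ?case by simp
qed

lemma cpoly_var_induct [case_names const add var]:
  assumes "\<And>c. P (const c)" "\<And>p q. P p \<Longrightarrow> P q \<Longrightarrow> P (p + q)" "\<And>v p. P p \<Longrightarrow> P (var v * p)"
  shows "P (p :: 'v cpoly)"
proof (induction p rule: cpoly_induct)
  case (single \<mu> c)
  show ?case
  proof (induction \<mu> rule: mon_induct)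
    case zero
    show ?case using assms(1)[of c] by (simp add: const_def)
  next
    case (sng_add v \<mu>)
    then show ?case using assms(3)[OF sng_add, of v] by (simp add: var_eq_pmon mult_single)
  qed
qed (rule assms(2))

lemma sng_add_diff:
  assumes "v \<in> Poly_Mapping.keys \<mu>"
  shows "sng v + (\<mu> - sng v) = \<mu>"
  using assms by (intro poly_mapping_eqI)
    (auto simp: lookup_add lookup_minus lookup_sng when_def in_keys_iff)


section \<open>Derivations\<close>

definition is_derivation :: "('a::comm_ring_1 \<Rightarrow> 'a) \<Rightarrow> bool"
  where "is_derivation D \<longleftrightarrow>
    (\<forall>p q. D (p + q) = D p + D q) \<and> (\<forall>p q. D (p * q) = D p * q + p * D q)"

lemma is_derivationD:
  assumes "is_derivation D"
  shows "D (p + q) = D p + D q" "D (p * q) = D p * q + p * D q" "D 0 = 0" "D 1 = 0"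
    "D (- p) = - D p" "D (p - q) = D p - D q"
proof -
  show add: "D (p + q) = D p + D q" for p q using assms by (simp add: is_derivation_def)
  show mult: "D (p * q) = D p * q + p * D q" for p q using assms by (simp add: is_derivation_def)
  show 0: "D 0 = 0" using add[of 0 0] by simp
  show "D 1 = 0" using mult[of 1 1] by simp
  show uminus: "D (- p) = - D p" for p using add[of p "- p"] 0 by (simp add: eq_neg_iff_add_eq_0 add.commute)
  show "D (p - q) = D p - D q" using add[of p "- q"] uminus[of q] by simp
qed

lemma is_derivation_commutator:
  assumes "is_derivation D" "is_derivation D'"
  shows "is_derivation (\<lambda>p. D (D' p) - D' (D p))"
  unfolding is_derivation_def
  by (auto simp: is_derivationD[OF assms(1)] is_derivationD[OF assms(2)] algebra_simps)

lemma is_derivation_diff: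
  assumes "is_derivation D" "is_derivation D'"
  shows "is_derivation (\<lambda>p. D p - D' p)"
  unfolding is_derivation_def
  by (auto simp: is_derivationD[OF assms(1)] is_derivationD[OF assms(2)] algebra_simps)

lemma is_derivation_if:
  assumes "is_derivation D"
  shows "is_derivation (\<lambda>p. if b then D p else 0)"
  unfolding is_derivation_def by (auto simp: is_derivationD[OF assms])

text \<open>\<open>is_derivation\<close> asks for additivity and the Leibniz rule but not for
  \<complex>-linearity, so the constants need a case of their own besides the
  indeterminates.\<close>

lemma is_derivation_eqI:
  fixes D D' :: "'v cpoly \<Rightarrow> 'v cpoly"
  assumes D: "is_derivation D" and D': "is_derivation D'"
    and "\<And>c. D (const c) = D' (const c)" "\<And>v. D (var v) = D' (var v)"
  shows "D p = D' p"
  by (induction p rule: cpoly_var_induct)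
    (simp_all add: assms(3,4) is_derivationD[OF D] is_derivationD[OF D'])

definition dmon :: "('v \<Rightarrow> 'v cpoly) \<Rightarrow> 'v mon \<Rightarrow> 'v cpoly"
  where "dmon \<delta> \<mu> =
    (\<Sum>v\<in>Poly_Mapping.keys \<mu>. of_nat (Poly_Mapping.lookup \<mu> v) * (pmon (\<mu> - sng v) * \<delta> v))"

definition derivation :: "('v \<Rightarrow> 'v cpoly) \<Rightarrow> 'v cpoly \<Rightarrow> 'v cpoly"
  where "derivation \<delta> p =
    (\<Sum>\<mu>\<in>Poly_Mapping.keys p. const (Poly_Mapping.lookup p \<mu>) * dmon \<delta> \<mu>)"

lemma dmon_superset:
  assumes "finite A" "Poly_Mapping.keys \<mu> \<subseteq> A"
  shows "dmon \<delta> \<mu> = (\<Sum>v\<in>A. of_nat (Poly_Mapping.lookup \<mu> v) * (pmon (\<mu> - sng v) * \<delta> v))"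
  unfolding dmon_def using assms
  by (intro sum.mono_neutral_left) (auto simp: in_keys_iff)

text \<open>Subtraction of exponents is truncated, so the two monomials need not agree when
  \<open>v\<close> does not divide \<open>\<mu>\<close>; in that case the coefficient vanishes on
  both sides.\<close>

lemma of_nat_mult_pmon_diff:
  "of_nat (Poly_Mapping.lookup \<mu> v) * pmon (\<mu> + \<nu> - sng v) =
    of_nat (Poly_Mapping.lookup \<mu> v) * pmon (\<mu> - sng v) * (pmon \<nu> :: 'v cpoly)"
proof (cases "v \<in> Poly_Mapping.keys \<mu>")
  case True
  then have "\<mu> + \<nu> - sng v = (\<mu> - sng v) + \<nu>"
    by (intro poly_mapping_eqI)
      (auto simp: lookup_add lookup_minus lookup_sng when_def in_keys_iff)
  then show ?thesis by (simp add: mult_single mult.assoc)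
qed (simp add: in_keys_iff)

lemma dmon_add: "dmon \<delta> (\<mu> + \<nu>) = dmon \<delta> \<mu> * pmon \<nu> + pmon \<mu> * dmon \<delta> \<nu>"
proof -
  let ?A = "Poly_Mapping.keys \<mu> \<union> Poly_Mapping.keys \<nu>"
  let ?l = "Poly_Mapping.lookup"
  have "dmon \<delta> (\<mu> + \<nu>) =
      (\<Sum>v\<in>?A. of_nat (?l (\<mu> + \<nu>) v) * (pmon (\<mu> + \<nu> - sng v) * \<delta> v))"
    by (intro dmon_superset Poly_Mapping.keys_add) auto
  also have "\<dots> = (\<Sum>v\<in>?A. (of_nat (?l \<mu> v) * pmon (\<mu> + \<nu> - sng v)) * \<delta> v +
      (of_nat (?l \<nu> v) * pmon (\<nu> + \<mu> - sng v)) * \<delta> v)"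
    by (simp add: lookup_add algebra_simps)
  also have "\<dots> = (\<Sum>v\<in>?A. of_nat (?l \<mu> v) * (pmon (\<mu> - sng v) * \<delta> v) * pmon \<nu> +
      pmon \<mu> * (of_nat (?l \<nu> v) * (pmon (\<nu> - sng v) * \<delta> v)))"
    unfolding of_nat_mult_pmon_diff by (simp add: mult_ac)
  also have "\<dots> = dmon \<delta> \<mu> * pmon \<nu> + pmon \<mu> * dmon \<delta> \<nu>"
    by (simp add: dmon_superset[of ?A] sum.distrib sum_distrib_left sum_distrib_right)
  finally show ?thesis .
qed

lemma derivation_superset:
  assumes "finite A" "Poly_Mapping.keys p \<subseteq> A"
  shows "derivation \<delta> p = (\<Sum>\<mu>\<in>A. const (Poly_Mapping.lookup p \<mu>) * dmon \<delta> \<mu>)"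
  unfolding derivation_def using assms
  by (intro sum.mono_neutral_left) (auto simp: in_keys_iff)

lemma derivation_single: "derivation \<delta> (Poly_Mapping.single \<mu> c) = const c * dmon \<delta> \<mu>"
  by (subst derivation_superset[of "{\<mu>}"]) auto

lemma derivation_add: "derivation \<delta> (p + q) = derivation \<delta> p + derivation \<delta> q"
proof -
  let ?A = "Poly_Mapping.keys p \<union> Poly_Mapping.keys q"
  have "derivation \<delta> (p + q) =
      (\<Sum>\<mu>\<in>?A. const (Poly_Mapping.lookup (p + q) \<mu>) * dmon \<delta> \<mu>)"
    by (intro derivation_superset Poly_Mapping.keys_add) auto
  then show ?thesis
    by (simp add: derivation_superset[of ?A] lookup_add const_add distrib_right sum.distrib)
qed

lemma is_derivation_derivation: "is_derivation (derivation \<delta>)"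
proof -
  have "derivation \<delta> (p * q) = derivation \<delta> p * q + p * derivation \<delta> q" for p q
  proof (induction p rule: cpoly_induct)
    case (single \<mu> c)
    show ?case
    proof (induction q rule: cpoly_induct)
      case (single \<nu> d)
      show ?case
        unfolding mult_single derivation_single dmon_add const_mult
        by (simp add: algebra_simps const_mult_pmon[of c \<mu>, symmetric] const_mult_pmon[of d \<nu>, symmetric])
    qed (simp add: derivation_add algebra_simps)
  qed (simp add: derivation_add algebra_simps)
  then show ?thesis by (simp add: is_derivation_def derivation_add)
qed

lemma derivation_const: "derivation \<delta> (const c) = 0"
  by (simp add: const_def derivation_single[unfolded const_def] dmon_def)

lemma derivation_var: "derivation \<delta> (var v) = \<delta> v"
  by (simp add: var_eq_pmon derivation_single dmon_def lookup_sng)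

text \<open>This description ignores coefficients, but it suffices to control the degrees and the
  indeterminates of an image.\<close>

lemma keys_derivation:
  assumes "\<nu> \<in> Poly_Mapping.keys (derivation \<delta> p)"
  obtains \<mu> v \<nu>' where "\<mu> \<in> Poly_Mapping.keys p" "v \<in> Poly_Mapping.keys \<mu>"
    "\<nu>' \<in> Poly_Mapping.keys (\<delta> v)" "\<nu> = (\<mu> - sng v) + \<nu>'"
proof -
  have const_keys: "Poly_Mapping.keys (const c * q) \<subseteq> Poly_Mapping.keys q" for c and q :: "'a cpoly"
    by (auto simp: in_keys_iff lookup_const_mult)
  have of_nat_const: "of_nat k = (const (of_nat k) :: 'a cpoly)" for k
    by (simp add: const_def)
  obtain \<mu> where \<mu>: "\<mu> \<in> Poly_Mapping.keys p"
    "\<nu> \<in> Poly_Mapping.keys (const (Poly_Mapping.lookup p \<mu>) * dmon \<delta> \<mu>)"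
    using assms keys_sum unfolding derivation_def by fastforce
  then have "\<nu> \<in> Poly_Mapping.keys (dmon \<delta> \<mu>)"
    using const_keys by blast
  then obtain v where v: "v \<in> Poly_Mapping.keys \<mu>"
    "\<nu> \<in> Poly_Mapping.keys (of_nat (Poly_Mapping.lookup \<mu> v) * (pmon (\<mu> - sng v) * \<delta> v))"
    using keys_sum unfolding dmon_def by fastforce
  then have "\<nu> \<in> Poly_Mapping.keys (pmon (\<mu> - sng v) * \<delta> v)"
    using const_keys unfolding of_nat_const by blast
  then show thesis
    using keys_mult[of "pmon (\<mu> - sng v)" "\<delta> v"] that[OF \<mu>(1) v(1)] by auto
qed


section \<open>Degrees\<close>

definition deg :: "('v \<Rightarrow> nat) \<Rightarrow> 'v mon \<Rightarrow> nat"
  where "deg w \<mu> = (\<Sum>v\<in>Poly_Mapping.keys \<mu>. Poly_Mapping.lookup \<mu> v * w v)"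

lemma deg_superset:
  assumes "finite A" "Poly_Mapping.keys \<mu> \<subseteq> A"
  shows "deg w \<mu> = (\<Sum>v\<in>A. Poly_Mapping.lookup \<mu> v * w v)"
  unfolding deg_def using assms
  by (intro sum.mono_neutral_left) (auto simp: in_keys_iff)

lemma deg_0 [simp]: "deg w 0 = 0"
  by (simp add: deg_def)

lemma deg_sng [simp]: "deg w (sng v) = w v"
  by (simp add: deg_def lookup_sng)

lemma deg_add [simp]: "deg w (\<mu> + \<nu>) = deg w \<mu> + deg w \<nu>"
proof -
  let ?A = "Poly_Mapping.keys \<mu> \<union> Poly_Mapping.keys \<nu>"
  have "deg w (\<mu> + \<nu>) = (\<Sum>v\<in>?A. Poly_Mapping.lookup (\<mu> + \<nu>) v * w v)"
    by (intro deg_superset Poly_Mapping.keys_add) auto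
  then show ?thesis
    by (simp add: deg_superset[of ?A] lookup_add distrib_right sum.distrib)
qed

lemma deg_eq_0_iff: "deg w \<mu> = 0 \<longleftrightarrow> (\<forall>v\<in>Poly_Mapping.keys \<mu>. w v = 0)"
  by (auto simp: deg_def in_keys_iff)

lemma deg_diff_sng:
  assumes "v \<in> Poly_Mapping.keys \<mu>"
  shows "w v + deg w (\<mu> - sng v) = deg w \<mu>"
  using arg_cong[OF sng_add_diff[OF assms], of "deg w"] by simp

text \<open>The degree is an integer because row operations shift it by differences that may be
  negative; for negative \<open>k\<close> only 0 is homogeneous.\<close>

definition homog :: "('v \<Rightarrow> nat) \<Rightarrow> int \<Rightarrow> 'v cpoly \<Rightarrow> bool"
  where "homog w k p \<longleftrightarrow> (\<forall>\<mu>\<in>Poly_Mapping.keys p. int (deg w \<mu>) = k)"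

lemma homogD: "homog w k p \<Longrightarrow> \<mu> \<in> Poly_Mapping.keys p \<Longrightarrow> int (deg w \<mu>) = k"
  by (simp add: homog_def)

lemma homog_subset: "homog w k p \<Longrightarrow> Poly_Mapping.keys q \<subseteq> Poly_Mapping.keys p \<Longrightarrow> homog w k q"
  by (auto simp: homog_def)

lemma homog_derivation:
  assumes p: "homog w k p"
    and \<delta>: "\<And>v. homog w (int (w v) + a) (\<delta> v)"
  shows "homog w (k + a) (derivation \<delta> p)"
  unfolding homog_def
proof
  fix \<nu> assume "\<nu> \<in> Poly_Mapping.keys (derivation \<delta> p)"
  then obtain \<mu> v \<nu>' where *: "\<mu> \<in> Poly_Mapping.keys p" "v \<in> Poly_Mapping.keys \<mu>"
    "\<nu>' \<in> Poly_Mapping.keys (\<delta> v)" "\<nu> = (\<mu> - sng v) + \<nu>'"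
    by (rule keys_derivation)
  then show "int (deg w \<nu>) = k + a"
    using homogD[OF p *(1)] homogD[OF \<delta> *(3)] deg_diff_sng[OF *(2), of w] by simp
qed

lemma derivation_eq_0:
  assumes "\<And>\<mu> v. \<mu> \<in> Poly_Mapping.keys p \<Longrightarrow> v \<in> Poly_Mapping.keys \<mu> \<Longrightarrow> \<delta> v = 0"
  shows "derivation \<delta> p = 0"
  using assms by (simp add: derivation_def dmon_def)

lemma derivation_euler:
  assumes p: "homog w (int k) p"
    and \<delta>: "\<And>\<mu> v. \<mu> \<in> Poly_Mapping.keys p \<Longrightarrow> v \<in> Poly_Mapping.keys \<mu> \<Longrightarrow> \<delta> v = of_nat (w v) * var v"
  shows "derivation \<delta> p = of_nat k * p"
proof -
  have "dmon \<delta> \<mu> = of_nat k * pmon \<mu>" if \<mu>: "\<mu> \<in> Poly_Mapping.keys p" for \<mu>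
  proof -
    have "dmon \<delta> \<mu> = (\<Sum>v\<in>Poly_Mapping.keys \<mu>. of_nat (Poly_Mapping.lookup \<mu> v * w v) * pmon \<mu>)"
      unfolding dmon_def
    proof (intro sum.cong refl)
      fix v assume v: "v \<in> Poly_Mapping.keys \<mu>"
      have "pmon (\<mu> - sng v) * \<delta> v = of_nat (w v) * (var v * pmon (\<mu> - sng v))"
        using \<delta>[OF \<mu> v] by (simp add: mult_ac)
      then show "of_nat (Poly_Mapping.lookup \<mu> v) * (pmon (\<mu> - sng v) * \<delta> v) =
          of_nat (Poly_Mapping.lookup \<mu> v * w v) * pmon \<mu>"
        by (simp add: var_mult_pmon sng_add_diff[OF v] mult.assoc)
    qed
    also have "\<dots> = of_nat (deg w \<mu>) * pmon \<mu>"
      by (simp add: deg_def sum_distrib_right)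
    finally show ?thesis using p \<mu> by (simp add: homog_def)
  qed
  then have "derivation \<delta> p =
      (\<Sum>\<mu>\<in>Poly_Mapping.keys p. of_nat k * (const (Poly_Mapping.lookup p \<mu>) * pmon \<mu>))"
    by (simp add: derivation_def mult_ac)
  also have "\<dots> = of_nat k * p"
    using cpoly_eq_sum[of p] by (simp flip: sum_distrib_left)
  finally show ?thesis .
qed

section \<open>Components selected by a property of the monomials\<close>

definition part :: "('v mon \<Rightarrow> bool) \<Rightarrow> 'v cpoly \<Rightarrow> 'v cpoly"
  where "part Q p = Poly_Mapping.mapp (\<lambda>\<mu> c. c when Q \<mu>) p"

lemma lookup_part: "Poly_Mapping.lookup (part Q p) \<mu> = (Poly_Mapping.lookup p \<mu> when Q \<mu>)"
  by (auto simp: part_def lookup_mapp when_def in_keys_iff)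

lemma keys_part: "Poly_Mapping.keys (part Q p) = {\<mu> \<in> Poly_Mapping.keys p. Q \<mu>}"
  by (auto simp: in_keys_iff lookup_part)

lemma part_add: "part Q (p + q) = part Q p + part Q q"
  by (rule poly_mapping_eqI) (simp add: lookup_part lookup_add when_def)

lemma part_eq_self:
  assumes "\<And>\<mu>. \<mu> \<in> Poly_Mapping.keys p \<Longrightarrow> Q \<mu>"
  shows "part Q p = p"
  using assms by (intro poly_mapping_eqI) (auto simp: lookup_part when_def in_keys_iff)

lemma sum_parts:
  assumes "finite K" "\<gamma> ` Poly_Mapping.keys p \<subseteq> K"
  shows "(\<Sum>g\<in>K. part (\<lambda>\<mu>. \<gamma> \<mu> = g) p) = p"
proof (rule poly_mapping_eqI)
  fix \<mu>
  show "Poly_Mapping.lookup (\<Sum>g\<in>K. part (\<lambda>\<mu>. \<gamma> \<mu> = g) p) \<mu> = Poly_Mapping.lookup p \<mu>"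
    using assms by (cases "\<mu> \<in> Poly_Mapping.keys p")
      (auto simp: lookup_sum lookup_part when_def in_keys_iff)
qed

lemma part_single: "part Q (Poly_Mapping.single \<mu> c) = (if Q \<mu> then Poly_Mapping.single \<mu> c else 0)"
  by (rule poly_mapping_eqI) (auto simp: lookup_part lookup_single when_def)

text \<open>Weights are nonnegative, so a product of monomials has degree 0 only if both factors do.
  Hence this projection is the substitution of 0 for all indeterminates of positive weight.\<close>

lemma part_deg_0_mult:
  "part (\<lambda>\<mu>. deg w \<mu> = 0) (p * q) = part (\<lambda>\<mu>. deg w \<mu> = 0) p * part (\<lambda>\<mu>. deg w \<mu> = 0) q"
proof (induction p rule: cpoly_induct)
  case (single \<mu> c)
  show ?case
    by (induction q rule: cpoly_induct)
      (simp_all add: mult_single part_single part_add distrib_left)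
qed (simp add: part_add distrib_right)

section \<open>Polarization operators in the abstract\<close>

locale gl_action =
  fixes E :: "nat \<Rightarrow> nat \<Rightarrow> 'r::comm_ring_1 \<Rightarrow> 'r" and x :: "nat \<Rightarrow> nat \<Rightarrow> 'r"
  assumes is_derivation_E: "is_derivation (E i j)"
    \<comment> \<open>The bracket of matrix units: on polynomials in the entries,
      \<open>E i j\<close> is the sum over \<open>c\<close> of the operators \<open>x i c\<close>
      d/d(\<open>x j c\<close>), which replaces row \<open>j\<close> by row
      \<open>i\<close>.\<close>
    and E_comm: "E i j (E k l p) =
      E k l (E i j p) + (if j = k then E i l p else 0) - (if l = i then E k j p else 0)"
    and E_x: "E i j (x r c) = (if r = j then x i c else 0)"
begin

lemmas E_simps = is_derivationD[OF is_derivation_E]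

text \<open>For \<open>j < m\<close>, row \<open>m + j\<close> serves as an auxiliary copy of row \<open>j\<close>.\<close>

definition restitute :: "nat \<Rightarrow> (nat \<Rightarrow> nat) \<Rightarrow> nat list \<Rightarrow> 'r \<Rightarrow> 'r"
  where "restitute m \<sigma> xs p = foldr (\<lambda>j. E (\<sigma> j) (m + j)) xs p"

definition polarize :: "nat \<Rightarrow> nat list \<Rightarrow> 'r \<Rightarrow> 'r"
  where "polarize m xs p = foldr (\<lambda>j. E (m + j) j) xs p"

lemma restitute_Nil [simp]: "restitute m \<sigma> [] p = p"
  and restitute_Cons: "restitute m \<sigma> (k # ys) p = E (\<sigma> k) (m + k) (restitute m \<sigma> ys p)"
  by (simp_all add: restitute_def)

lemma polarize_Nil [simp]: "polarize m [] p = p"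
  and polarize_Cons: "polarize m (k # ys) p = E (m + k) k (polarize m ys p)"
  by (simp_all add: polarize_def)

lemma restitute_add: "restitute m \<sigma> xs (p + q) = restitute m \<sigma> xs p + restitute m \<sigma> xs q"
  by (induction xs) (simp_all add: restitute_Cons E_simps)

lemma restitute_0: "restitute m \<sigma> xs 0 = 0"
  by (induction xs) (simp_all add: restitute_Cons E_simps)

lemma restitute_sum: "restitute m \<sigma> xs (sum f A) = (\<Sum>a\<in>A. restitute m \<sigma> xs (f a))"
  by (induction A rule: infinite_finite_induct) (simp_all add: restitute_add restitute_0)

lemma restitute_cong: "(\<And>j. j \<in> set xs \<Longrightarrow> \<sigma> j = \<tau> j) \<Longrightarrow> restitute m \<sigma> xs p = restitute m \<tau> xs p"
  by (induction xs) (simp_all add: restitute_Cons)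

lemma restitute_E_commute:
  assumes "\<And>j. j \<in> set xs \<Longrightarrow> m + j \<noteq> k \<and> \<sigma> j \<noteq> l"
  shows "restitute m \<sigma> xs (E k l p) = E k l (restitute m \<sigma> xs p)"
  using assms
proof (induction xs)
  case (Cons j xs)
  then show ?case
    by (auto simp: restitute_Cons E_comm[of "\<sigma> j" "m + j" k l])
qed simp

text \<open>Each operator moves an auxiliary row, at least \<open>m\<close>, to a row below
  \<open>m\<close>, so the operators commute and any of them can be brought to the front.\<close>

lemma restitute_remove1:
  assumes "l \<in> set xs" "\<And>j. j \<in> set xs \<Longrightarrow> \<sigma> j < m"
  shows "restitute m \<sigma> xs p = E (\<sigma> l) (m + l) (restitute m \<sigma> (remove1 l xs) p)"
  using assms
proof (induction xs)
  case (Cons k xs)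
  show ?case
  proof (cases "k = l")
    case False
    have "\<sigma> k < m" "\<sigma> l < m" using Cons.prems by auto
    moreover have "restitute m \<sigma> xs p = E (\<sigma> l) (m + l) (restitute m \<sigma> (remove1 l xs) p)"
      using Cons False by auto
    ultimately show ?thesis using False
      by (simp add: restitute_Cons E_comm[of "\<sigma> k" "m + k" "\<sigma> l" "m + l"])
  qed (simp add: restitute_Cons)
qed simp

lemma restitute_remove1_inner:
  assumes "l \<in> set xs" "\<And>j. j \<in> set xs \<Longrightarrow> \<sigma> j < m"
  shows "restitute m \<sigma> xs p = restitute m \<sigma> (remove1 l xs) (E (\<sigma> l) (m + l) p)"
proof -
  have "m + j \<noteq> \<sigma> l \<and> \<sigma> j \<noteq> m + l" if "j \<in> set (remove1 l xs)" for j
    using assms(2)[of l] assms(2)[of j] assms(1) notin_set_remove1[of j xs l] that by fastforce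
  then show ?thesis
    using restitute_remove1[OF assms] restitute_E_commute[of "remove1 l xs" m "\<sigma> l" \<sigma> "m + l" p] by simp
qed

lemma restitute_mult_left:
  assumes "\<And>j. j \<in> set xs \<Longrightarrow> E (\<sigma> j) (m + j) a = 0"
  shows "restitute m \<sigma> xs (a * p) = a * restitute m \<sigma> xs p"
  using assms by (induction xs) (simp_all add: restitute_Cons E_simps)

text \<open>Only the operator of \<open>l\<close> affects row \<open>m + l\<close>. Since it kills
  \<open>p\<close>, the Leibniz rule leaves just the term in which it acts on the entry.\<close>

lemma restitute_x_mult:
  assumes "l \<in> set xs" "\<And>j. j \<in> set xs \<Longrightarrow> \<sigma> j < m" "E (\<sigma> l) (m + l) p = 0"
  shows "restitute m \<sigma> xs (x (m + l) c * p) = x (\<sigma> l) c * restitute m \<sigma> (remove1 l xs) p"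
proof -
  have "restitute m \<sigma> xs (x (m + l) c * p) = restitute m \<sigma> (remove1 l xs) (x (\<sigma> l) c * p)"
    using restitute_remove1_inner[OF assms(1,2)] by (simp add: E_simps E_x assms(3))
  also have "\<dots> = x (\<sigma> l) c * restitute m \<sigma> (remove1 l xs) p"
    using assms(2)[OF assms(1)] by (intro restitute_mult_left) (simp add: E_x)
  finally show ?thesis .
qed

text \<open>In the next two lemmas \<open>Y\<close> has degree 0 in the auxiliary row \<open>m + k\<close>, which is what the
  vanishing assumptions say.\<close>

lemma capelli_fixed:
  assumes "k < m" "\<sigma> k = k" "k \<notin> set ys" "\<And>j. j \<in> set ys \<Longrightarrow> \<sigma> j \<noteq> k"
    and Y: "Y = restitute m \<sigma> ys (polarize m ys f)"
    and "E k (m + k) Y = 0" "E (m + k) (m + k) Y = 0"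
  shows "restitute m \<sigma> (k # ys) (polarize m (k # ys) f) = E k k Y"
proof -
  have "restitute m \<sigma> ys (E (m + k) k (polarize m ys f)) = E (m + k) k Y"
    unfolding Y using assms(3,4) by (intro restitute_E_commute) auto
  \<comment> \<open>The commutator of \<open>E k (m + k)\<close> and \<open>E (m + k) k\<close> is
    \<open>E k k - E (m + k) (m + k)\<close>. As \<open>Y\<close> has degree 0 in row
    \<open>m + k\<close>, only \<open>E k k Y\<close> survives.\<close>
  then show ?thesis
    using assms by (simp add: restitute_Cons polarize_Cons E_comm[of k "m + k" "m + k" k] E_simps)
qed

lemma capelli_moved:
  assumes k: "k < m" "k \<notin> set ys" and p: "\<sigma> k \<noteq> k" "\<sigma> k < m"
    and ys: "distinct ys" "\<And>j. j \<in> set ys \<Longrightarrow> \<sigma> j < m"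
    and l: "l \<in> set ys" "\<And>j. j \<in> set ys \<Longrightarrow> \<sigma> j = k \<longleftrightarrow> j = l"
    and Y: "Y = restitute m \<sigma> (remove1 l ys) (polarize m ys f)"
    and "E (\<sigma> k) (m + k) Y = 0" "E (\<sigma> k) (m + k) (E k (m + l) Y) = 0"
  shows "restitute m \<sigma> (k # ys) (polarize m (k # ys) f) =
    E (\<sigma> k) k (restitute m \<sigma> ys (polarize m ys f)) - E (\<sigma> k) (m + l) Y"
proof -
  have sl: "\<sigma> l = k" and kl: "k \<noteq> l" using l k by auto
  \<comment> \<open>Among the operators of \<open>ys\<close>, the one of \<open>l\<close> is the
    only one with target \<open>k\<close>, hence the only one that fails to commute with
    \<open>E (m + k) k\<close>. It is singled out.\<close>
  have U: "restitute m \<sigma> ys q = E k (m + l) (restitute m \<sigma> (remove1 l ys) q)" for q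
    using restitute_remove1[OF l(1) ys(2)] by (simp add: sl)
  have "restitute m \<sigma> (remove1 l ys) (E (m + k) k (polarize m ys f)) = E (m + k) k Y"
    unfolding Y using k l ys by (intro restitute_E_commute) auto
  then have "restitute m \<sigma> (k # ys) (polarize m (k # ys) f) =
      E (\<sigma> k) (m + k) (E k (m + l) (E (m + k) k Y))"
    by (simp add: restitute_Cons polarize_Cons U)
  also have "E k (m + l) (E (m + k) k Y) = E (m + k) k (E k (m + l) Y) - E (m + k) (m + l) Y"
    using kl by (simp add: E_comm[of k "m + l" "m + k" k])
  \<comment> \<open>Because \<open>E (\<sigma> k) (m + k)\<close> kills both \<open>Y\<close> and
    \<open>E k (m + l) Y\<close>, only its commutators with \<open>E (m + k) k\<close> and
    \<open>E (m + k) (m + l)\<close> contribute.\<close>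
  also have "E (\<sigma> k) (m + k) \<dots> =
      E (\<sigma> k) k (E k (m + l) Y) - E (\<sigma> k) (m + l) Y"
    using assms
    by (simp add: E_simps E_comm[of "\<sigma> k" "m + k" "m + k"])
  finally show ?thesis by (simp add: U Y)
qed

end


section \<open>Row operations\<close>

text \<open>Extends the minor symbols alternatingly to all pairs of rows, since a row operation can
  put the rows out of order or make them equal.\<close>

fun bracket :: "nat \<Rightarrow> nat \<Rightarrow> nat \<times> nat \<Rightarrow> sr_var cpoly"
  where "bracket a b cc =
    (if a < b then var (Inr ((a, b), cc)) else if b < a then - var (Inr ((b, a), cc)) else 0)"

fun row_var :: "nat \<Rightarrow> nat \<Rightarrow> sr_var \<Rightarrow> sr_var cpoly"
  where
    "row_var i j (Inl (r, c)) = (if r = j then var (Inl (i, c)) else 0)"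
  | "row_var i j (Inr ((r, r'), cc)) =
      (if r = j then bracket i r' cc else 0) + (if r' = j then bracket r i cc else 0)"

fun row_entry :: "nat \<Rightarrow> nat \<Rightarrow> entry \<Rightarrow> entry cpoly"
  where "row_entry i j (r, c) = (if r = j then var (i, c) else 0)"

definition row_op :: "nat \<Rightarrow> nat \<Rightarrow> sr_var cpoly \<Rightarrow> sr_var cpoly"
  where "row_op i j = derivation (row_var i j)"

definition row_op_S :: "nat \<Rightarrow> nat \<Rightarrow> entry cpoly \<Rightarrow> entry cpoly"
  where "row_op_S i j = derivation (row_entry i j)"

lemma row_op_var [simp]: "row_op i j (var v) = row_var i j v"
  by (simp add: row_op_def derivation_var)

lemma row_op_S_var [simp]: "row_op_S i j (var v) = row_entry i j v"
  by (simp add: row_op_S_def derivation_var)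

lemma is_derivation_row_op: "is_derivation (row_op i j)"
  and is_derivation_row_op_S: "is_derivation (row_op_S i j)"
  by (simp_all add: row_op_def row_op_S_def is_derivation_derivation)

lemmas row_op_simps = is_derivationD[OF is_derivation_row_op]
lemmas row_op_S_simps = is_derivationD[OF is_derivation_row_op_S]

lemma row_op_const [simp]: "row_op i j (const c) = 0"
  by (simp add: row_op_def derivation_const)

lemma row_op_S_const [simp]: "row_op_S i j (const c) = 0"
  by (simp add: row_op_S_def derivation_const)

lemma row_op_bracket:
  "row_op i j (bracket a b cc) =
    (if a = j then bracket i b cc else 0) + (if b = j then bracket a i cc else 0)"
  by (auto simp: row_op_simps)

lemma row_op_commutator_var:
  "row_op i j (row_op k l (var v)) = row_op k l (row_op i j (var v))
    + (if j = k then row_op i l (var v) else 0) - (if l = i then row_op k j (var v) else 0)"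
proof (cases v)
  case (Inl e)
  then show ?thesis by (cases e) (auto simp: row_op_simps)
next
  case (Inr q)
  then obtain r r' cc where "v = Inr ((r, r'), cc)" by (metis surj_pair)
  then show ?thesis
    by (auto simp: row_op_bracket row_op_simps simp del: bracket.simps)
qed

lemma row_op_S_commutator_var:
  "row_op_S i j (row_op_S k l (var v)) = row_op_S k l (row_op_S i j (var v))
    + (if j = k then row_op_S i l (var v) else 0) - (if l = i then row_op_S k j (var v) else 0)"
  by (cases v) (auto simp: row_op_S_simps)

text \<open>A commutator of derivations is a derivation, so the bracket relation needs checking only
  on constants and indeterminates.\<close>

lemma commutator_eqI:
  fixes E :: "nat \<Rightarrow> nat \<Rightarrow> 'v cpoly \<Rightarrow> 'v cpoly"
  assumes E: "\<And>i j. is_derivation (E i j)" and const: "\<And>i j c. E i j (const c) = 0"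
    and var: "\<And>i j k l v. E i j (E k l (var v)) = E k l (E i j (var v)) +
      (if j = k then E i l (var v) else 0) - (if l = i then E k j (var v) else 0)"
  shows "E i j (E k l p) =
      E k l (E i j p) + (if j = k then E i l p else 0) - (if l = i then E k j p else 0)"
proof -
  have "E i j (E k l p) - E k l (E i j p) =
      (if j = k then E i l p else 0) - (if l = i then E k j p else 0)"
  proof (rule is_derivation_eqI[where p = p and D = "\<lambda>p. E i j (E k l p) - E k l (E i j p)"
        and D' = "\<lambda>p. (if j = k then E i l p else 0) - (if l = i then E k j p else 0)"])
    show "is_derivation (\<lambda>p. E i j (E k l p) - E k l (E i j p))"
      by (intro is_derivation_commutator E)
    show "is_derivation (\<lambda>p. (if j = k then E i l p else 0) - (if l = i then E k j p else 0))"
      by (intro is_derivation_diff is_derivation_if E)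
    show "E i j (E k l (const c)) - E k l (E i j (const c)) =
        (if j = k then E i l (const c) else 0) - (if l = i then E k j (const c) else 0)" for c
      by (simp add: const is_derivationD(3)[OF E])
    show "E i j (E k l (var v)) - E k l (E i j (var v)) =
        (if j = k then E i l (var v) else 0) - (if l = i then E k j (var v) else 0)" for v
      unfolding var[of i j k l v] by simp
  qed
  then show ?thesis by (simp add: algebra_simps)
qed

text \<open>\<open>P\<close> is the action on S \<otimes> R and \<open>S\<close> below is the one on
  S, so polarization and restitution are available on both sides of \<Pi>.\<close>

interpretation P: gl_action row_op "\<lambda>r c. var (Inl (r, c))"
proof
  show "row_op i j (row_op k l p) = row_op k l (row_op i j p)
      + (if j = k then row_op i l p else 0) - (if l = i then row_op k j p else 0)" for i j k l p
    by (rule commutator_eqI[OF is_derivation_row_op row_op_const row_op_commutator_var])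
qed (auto simp: is_derivation_row_op)

interpretation S: gl_action row_op_S "\<lambda>r c. var (r, c)"
proof
  show "row_op_S i j (row_op_S k l p) = row_op_S k l (row_op_S i j p)
      + (if j = k then row_op_S i l p else 0) - (if l = i then row_op_S k j p else 0)" for i j k l p
    by (rule commutator_eqI[OF is_derivation_row_op_S row_op_S_const row_op_S_commutator_var])
qed (auto simp: is_derivation_row_op_S)

section \<open>Equivariance of \<Pi>\<close>

definition rees_coeff :: "nat \<Rightarrow> sr_var cpoly \<Rightarrow> entry cpoly"
  where "rees_coeff k p = poly.coeff (rees_map p) k"

lemma rees_coeff_add: "rees_coeff k (p + q) = rees_coeff k p + rees_coeff k q"
  by (simp add: rees_coeff_def rees_map_add)

lemma rees_coeff_0 [simp]: "rees_coeff k 0 = 0"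
  by (simp add: rees_coeff_def rees_map_def)

lemma rees_coeff_sum: "rees_coeff k (sum f A) = (\<Sum>a\<in>A. rees_coeff k (f a))"
  by (induction A rule: infinite_finite_induct) (simp_all add: rees_coeff_add)

lemma rees_coeff_uminus: "rees_coeff k (- p) = - rees_coeff k p"
  using rees_coeff_add[of k p "- p"] by (simp add: eq_neg_iff_add_eq_0 add.commute)

lemma rees_map_eq_0_iff: "rees_map p = 0 \<longleftrightarrow> (\<forall>k. rees_coeff k p = 0)"
  by (simp add: rees_coeff_def poly_eq_iff)

lemma rees_coeff_Inl: "rees_coeff k (var (Inl e) * p) = var e * rees_coeff k p"
  by (simp add: rees_coeff_def rees_map_mult rees_map_var)

lemma rees_coeff_Inr:
  "rees_coeff k (var (Inr q) * p) = (case k of 0 \<Rightarrow> 0 | Suc k' \<Rightarrow> minor q * rees_coeff k' p)"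
  by (cases k) (simp_all add: rees_coeff_def rees_map_mult rees_map_var)

lemma minor_swap: "minor ((b, a), cc) = - minor ((a, b), cc)"
  by (cases cc) (simp add: mult.commute)

lemma rees_coeff_bracket:
  "rees_coeff k (bracket a b cc * p) =
    (case k of 0 \<Rightarrow> 0 | Suc k' \<Rightarrow> minor ((a, b), cc) * rees_coeff k' p)"
proof -
  have "minor ((a, a), cc) = 0" by (cases cc) (simp add: mult.commute)
  then show ?thesis
    by (auto simp: rees_coeff_Inr rees_coeff_uminus minor_swap[of a b] simp del: minor.simps
        split: nat.split)
qed

lemma row_op_S_minor:
  "row_op_S i j (minor ((r, r'), cc)) =
    (if r = j then minor ((i, r'), cc) else 0) + (if r' = j then minor ((r, i), cc) else 0)"
  by (cases cc) (auto simp: row_op_S_simps)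

text \<open>By the Leibniz rule it suffices to compare the two actions on indeterminates. There it
  comes down to \<open>minor\<close> being bilinear and alternating in its two rows.\<close>

lemma rees_coeff_row_op: "rees_coeff k (row_op i j p) = row_op_S i j (rees_coeff k p)"
proof (induction p arbitrary: k rule: cpoly_var_induct)
  case (const c)
  have "rees_coeff k (const c) = (if k = 0 then const c else 0)"
    by (cases k) (simp_all add: rees_coeff_def rees_map_const)
  then show ?case by (simp add: row_op_S_simps)
next
  case (add p q)
  then show ?case by (simp add: row_op_simps row_op_S_simps rees_coeff_add)
next
  case (var v p)
  show ?case
  proof (cases v)
    case (Inl e)
    then show ?thesis
      by (cases e) (auto simp: row_op_simps row_op_S_simps rees_coeff_add rees_coeff_Inl var)
  next
    case (Inr q)
    then obtain r r' cc where "v = Inr ((r, r'), cc)" by (metis surj_pair)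
    then show ?thesis
      by (auto simp: row_op_simps row_op_S_simps rees_coeff_add rees_coeff_Inr rees_coeff_bracket
          row_op_S_minor var distrib_right simp del: minor.simps bracket.simps split: nat.split)
  qed
qed

lemma rees_coeff_restitute: "rees_coeff k (P.restitute m \<sigma> xs p) = S.restitute m \<sigma> xs (rees_coeff k p)"
  by (induction xs) (simp_all add: P.restitute_Cons S.restitute_Cons rees_coeff_row_op)


section \<open>Gradings\<close>

text \<open>One family for all gradings in use: \<open>z\<close> weighs the entries,
  \<open>s\<close> is added for each entry and \<open>t\<close> for each minor symbol. A minor
  symbol gets the \<open>z\<close>-weight of its diagonal term; if \<open>z\<close> depends on the
  row alone or on the column alone, the other term has the same weight.\<close>

fun wt :: "(entry \<Rightarrow> nat) \<Rightarrow> nat \<Rightarrow> nat \<Rightarrow> sr_var \<Rightarrow> nat"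
  where
    "wt z s t (Inl e) = z e + s"
  | "wt z s t (Inr ((r, r'), (c, c'))) = z (r, c) + z (r', c') + t"

abbreviation row_wt :: "(nat \<Rightarrow> nat) \<Rightarrow> entry \<Rightarrow> nat"
  where "row_wt u \<equiv> \<lambda>(r, c). u r"

abbreviation rdeg :: "nat \<Rightarrow> sr_var \<Rightarrow> nat"
  where "rdeg r \<equiv> wt (row_wt (\<lambda>i. of_bool (i = r))) 0 0"

abbreviation xdeg :: "sr_var \<Rightarrow> nat"
  where "xdeg \<equiv> wt (row_wt (\<lambda>_. 0)) 1 0"

abbreviation tdeg :: "sr_var \<Rightarrow> nat"
  where "tdeg \<equiv> wt (row_wt (\<lambda>_. 0)) 0 1"

lemma homog_0 [simp]: "homog w k 0"
  by (simp add: homog_def)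

lemma homog_var [simp]: "homog w k (var v) \<longleftrightarrow> int (w v) = k"
  by (simp add: homog_def)

lemma homog_uminus [simp]: "homog w k (- p) \<longleftrightarrow> homog w k p"
  by (simp add: homog_def)

lemma homog_add: "homog w k p \<Longrightarrow> homog w k q \<Longrightarrow> homog w k (p + q)"
  using Poly_Mapping.keys_add[of p q] by (auto simp: homog_def)

lemma homog_row_op:
  assumes "homog (wt (row_wt u) s t) k p"
  shows "homog (wt (row_wt u) s t) (k + (int (u i) - int (u j))) (row_op i j p)"
  unfolding row_op_def
proof (rule homog_derivation[OF assms])
  fix v
  show "homog (wt (row_wt u) s t) (int (wt (row_wt u) s t v) + (int (u i) - int (u j))) (row_var i j v)"
  proof (cases v)
    case (Inl e)
    then show ?thesis by (cases e) auto
  next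
    case (Inr q)
    then obtain r r' c c' where "v = Inr ((r, r'), (c, c'))" by (metis surj_pair)
    then show ?thesis by (auto intro!: homog_add)
  qed
qed

lemma homog_restitute:
  assumes "homog (wt (row_wt u) s t) k p"
  shows "homog (wt (row_wt u) s t) (k + (\<Sum>j\<leftarrow>xs. int (u (\<sigma> j)) - int (u (m + j)))) (P.restitute m \<sigma> xs p)"
proof (induction xs)
  case (Cons j xs)
  then show ?case
    using homog_row_op[OF Cons, of "\<sigma> j" "m + j"] by (simp add: P.restitute_Cons algebra_simps)
qed (simp add: assms)

lemma homog_polarize:
  assumes "homog (wt (row_wt u) s t) k p"
  shows "homog (wt (row_wt u) s t) (k + (\<Sum>j\<leftarrow>xs. int (u (m + j)) - int (u j))) (P.polarize m xs p)"
proof (induction xs)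
  case (Cons j xs)
  then show ?case
    using homog_row_op[OF Cons, of "m + j" j] by (simp add: P.polarize_Cons algebra_simps)
qed (simp add: assms)

lemma row_op_eq_0:
  assumes "homog (rdeg j) 0 p"
  shows "row_op i j p = 0"
  unfolding row_op_def
proof (rule derivation_eq_0)
  fix \<mu> v assume "\<mu> \<in> Poly_Mapping.keys p" "v \<in> Poly_Mapping.keys \<mu>"
  then have "rdeg j v = 0"
    using homogD[OF assms] deg_eq_0_iff[of "rdeg j" \<mu>] by auto
  then show "row_var i j v = 0"
    by (cases "(row_wt (\<lambda>_. 0), 0::nat, 0::nat, v)" rule: wt.cases) auto
qed

lemma row_op_S_eq_0:
  assumes "homog (row_wt (\<lambda>i. of_bool (i = j))) 0 p"
  shows "row_op_S i j p = 0"
  unfolding row_op_S_def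
proof (rule derivation_eq_0)
  fix \<mu> v assume "\<mu> \<in> Poly_Mapping.keys p" "v \<in> Poly_Mapping.keys \<mu>"
  then have "(row_wt (\<lambda>i. of_bool (i = j))) v = 0"
    using homogD[OF assms] deg_eq_0_iff[of "row_wt (\<lambda>i. of_bool (i = j))" \<mu>] by auto
  then show "row_entry i j v = 0"
    by (cases v) auto
qed

text \<open>\<Pi> respects the grading because the condition on \<open>z\<close> gives both terms of
  a minor the same weight, and the exponent of t counts the minor symbols. The extra weight per
  entry is 0 here, as a minor symbol does not carry it although its image consists of
  entries.\<close>

lemma keys_rees_mon:
  assumes "\<nu> \<in> Poly_Mapping.keys (poly.coeff (rees_mon \<mu>) k)"
    and z: "\<And>r r' c c'. z (r, c) + z (r', c') = z (r, c') + z (r', c)"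
  shows "deg (wt z 0 t) \<mu> = deg z \<nu> + t * k"
  using assms(1)
proof (induction \<mu> arbitrary: \<nu> k rule: mon_induct)
  case zero
  then show ?case by (cases k) (auto simp: rees_mon_0 split: if_splits)
next
  case (sng_add v \<mu>)
  have mon: "rees_mon (sng v + \<mu>) = rees_var v * rees_mon \<mu>"
    unfolding rees_mon_add by (simp add: rees_mon_def[of "sng v"] lookup_sng)
  show ?case
  proof (cases v)
    case (Inl e)
    then have "\<nu> \<in> Poly_Mapping.keys (var e * poly.coeff (rees_mon \<mu>) k)"
      using sng_add.prems unfolding mon by simp
    then obtain \<nu>' where "\<nu> = sng e + \<nu>'" "\<nu>' \<in> Poly_Mapping.keys (poly.coeff (rees_mon \<mu>) k)"
      using keys_mult[of "var e"] by fastforce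
    then show ?thesis using sng_add.IH by (simp add: Inl)
  next
    case (Inr q)
    then obtain r r' c c' where v: "v = Inr ((r, r'), (c, c'))" by (metis surj_pair)
    obtain k' where k: "k = Suc k'"
      and "\<nu> \<in> Poly_Mapping.keys (minor ((r, r'), (c, c')) * poly.coeff (rees_mon \<mu>) k')"
      using sng_add.prems mon[unfolded v] by (cases k) (simp_all add: v del: minor.simps)
    then obtain a \<nu>' where a: "a \<in> Poly_Mapping.keys (minor ((r, r'), (c, c')))" "\<nu> = a + \<nu>'"
      and \<nu>': "\<nu>' \<in> Poly_Mapping.keys (poly.coeff (rees_mon \<mu>) k')"
      using keys_mult[of "minor ((r, r'), (c, c'))"] by blast
    have "a = sng (r, c) + sng (r', c') \<or> a = sng (r, c') + sng (r', c)"
      using a(1) keys_diff[of "var (r, c) * var (r', c')" "var (r, c') * var (r', c)"]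
      by (auto simp: var_eq_pmon mult_single split: if_splits)
    then show ?thesis using sng_add.IH[OF \<nu>'] z[of r c r' c'] by (auto simp: v k a(2))
  qed
qed

lemma lookup_rees_coeff:
  "Poly_Mapping.lookup (rees_coeff k p) \<nu> =
    (\<Sum>\<mu>\<in>Poly_Mapping.keys p. Poly_Mapping.lookup p \<mu> *
      Poly_Mapping.lookup (poly.coeff (rees_mon \<mu>) k) \<nu>)"
  by (simp add: rees_coeff_def rees_map_def coeff_sum lookup_sum lookup_const_mult)

lemma keys_rees_coeff:
  assumes "\<nu> \<in> Poly_Mapping.keys (rees_coeff k p)"
  obtains \<mu> where "\<mu> \<in> Poly_Mapping.keys p" "\<nu> \<in> Poly_Mapping.keys (poly.coeff (rees_mon \<mu>) k)"
proof -
  have "\<exists>\<mu>\<in>Poly_Mapping.keys p. Poly_Mapping.lookup (poly.coeff (rees_mon \<mu>) k) \<nu> \<noteq> 0"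
    using assms by (auto simp: in_keys_iff lookup_rees_coeff intro: ccontr)
  then show thesis using that by (auto simp: in_keys_iff)
qed

text \<open>Only monomials with \<open>\<gamma> \<mu> = \<gamma>' \<nu> k\<close> contribute to
  \<open>\<nu>\<close> in the coefficient of t^k. So passing to the part either keeps the
  coefficient of \<open>\<nu>\<close> or replaces it by 0, and for a relation it was 0
  before.\<close>

lemma rees_map_part:
  assumes p: "rees_map p = 0"
    and \<gamma>: "\<And>\<mu> k \<nu>. \<nu> \<in> Poly_Mapping.keys (poly.coeff (rees_mon \<mu>) k) \<Longrightarrow> \<gamma> \<mu> = \<gamma>' \<nu> k"
  shows "rees_map (part (\<lambda>\<mu>. \<gamma> \<mu> = g) p) = 0"
  unfolding rees_map_eq_0_iff
proof (intro allI poly_mapping_eqI)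
  fix k \<nu>
  let ?L = "\<lambda>\<mu>. Poly_Mapping.lookup (poly.coeff (rees_mon \<mu>) k) \<nu>"
  let ?p = "part (\<lambda>\<mu>. \<gamma> \<mu> = g) p"
  have "Poly_Mapping.lookup (rees_coeff k ?p) \<nu> =
      (\<Sum>\<mu>\<in>Poly_Mapping.keys p. Poly_Mapping.lookup ?p \<mu> * ?L \<mu>)"
    unfolding lookup_rees_coeff
    by (intro sum.mono_neutral_left) (auto simp: keys_part in_keys_iff lookup_part)
  also have "\<dots> = (\<Sum>\<mu>\<in>Poly_Mapping.keys p. of_bool (\<gamma>' \<nu> k = g) * (Poly_Mapping.lookup p \<mu> * ?L \<mu>))"
  proof (intro sum.cong refl)
    fix \<mu>
    show "Poly_Mapping.lookup ?p \<mu> * ?L \<mu> = of_bool (\<gamma>' \<nu> k = g) * (Poly_Mapping.lookup p \<mu> * ?L \<mu>)"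
      using \<gamma>[of \<nu> \<mu> k] by (cases "?L \<mu> = 0") (auto simp: in_keys_iff lookup_part)
  qed
  also have "\<dots> = of_bool (\<gamma>' \<nu> k = g) * Poly_Mapping.lookup (rees_coeff k p) \<nu>"
    by (simp add: lookup_rees_coeff sum_distrib_left)
  also have "\<dots> = 0" using p by (simp add: rees_map_eq_0_iff)
  finally show "Poly_Mapping.lookup (rees_coeff k ?p) \<nu> = Poly_Mapping.lookup 0 \<nu>" by simp
qed

section \<open>The ideals\<close>

text \<open>Rows are unlimited, so that row operations act and auxiliary rows are always available;
  the number of columns remains \<open>n\<close>.\<close>

definition generic_vars :: "nat \<Rightarrow> sr_var set"
  where "generic_vars n = (\<Union>m. Inl ` entries m n \<union> Inr ` minor_indices m n)"

definition relations :: "nat \<Rightarrow> sr_var cpoly set"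
  where "relations n = {p. indets p \<subseteq> generic_vars n \<and> rees_map p = 0}"

text \<open>The analogue, with unlimited rows, of the ideal in the definition of fiber type. As
  \<open>tdeg\<close> counts a minor symbol once, the generators have bi-degree (d, 2e) with d = 0
  or e = 1.\<close>

inductive_set fiber_ideal :: "nat \<Rightarrow> sr_var cpoly set" for n
  where
    generator: "p \<in> relations n \<Longrightarrow> homog xdeg (int d) p \<Longrightarrow> homog tdeg (int e) p \<Longrightarrow> d = 0 \<or> e = 1 \<Longrightarrow>
      p \<in> fiber_ideal n"
  | add: "p \<in> fiber_ideal n \<Longrightarrow> q \<in> fiber_ideal n \<Longrightarrow> p + q \<in> fiber_ideal n"
  | mult: "indets r \<subseteq> generic_vars n \<Longrightarrow> p \<in> fiber_ideal n \<Longrightarrow> r * p \<in> fiber_ideal n"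

lemma Inl_generic_vars: "Inl (r, c) \<in> generic_vars n \<longleftrightarrow> c < n"
  by (auto simp: generic_vars_def entries_def)

lemma Inr_generic_vars: "Inr ((r, r'), (c, c')) \<in> generic_vars n \<longleftrightarrow> r < r' \<and> c < c' \<and> c' < n"
  by (auto simp: generic_vars_def minor_indices_def)

lemma indets_mono: "Poly_Mapping.keys q \<subseteq> Poly_Mapping.keys p \<Longrightarrow> indets q \<subseteq> indets p"
  by (auto simp: indets_def)

lemma indets_const [simp]: "indets (const c) = {}"
  by (auto simp: indets_def const_def)

lemma indets_var [simp]: "indets (var v) = {v}"
  by (simp add: indets_def)

lemma indets_pmon: "\<mu> \<in> Poly_Mapping.keys p \<Longrightarrow> indets (pmon \<mu>) \<subseteq> indets p"
  by (auto simp: indets_def)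

lemma indets_pmon_diff: "indets (pmon (\<mu> - \<nu>)) \<subseteq> indets (pmon \<mu>)"
  by (auto simp: indets_def in_keys_iff lookup_minus)

lemma indets_sum_subset: "(\<And>a. a \<in> A \<Longrightarrow> indets (f a) \<subseteq> V) \<Longrightarrow> indets (sum f A) \<subseteq> V"
proof (induction A rule: infinite_finite_induct)
  case (insert a A)
  then show ?case using indets_add[of "f a" "sum f A"] by auto
qed (simp_all add: indets_0_1)

lemma indets_add_subset: "indets p \<subseteq> V \<Longrightarrow> indets q \<subseteq> V \<Longrightarrow> indets (p + q) \<subseteq> V"
  using indets_add[of p q] by blast

lemma indets_mult_subset: "indets p \<subseteq> V \<Longrightarrow> indets q \<subseteq> V \<Longrightarrow> indets (p * q) \<subseteq> V"
  using indets_mult[of p q] by blast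

lemma indets_row_op:
  assumes "indets p \<subseteq> generic_vars n"
  shows "indets (row_op i j p) \<subseteq> generic_vars n"
proof
  fix v assume "v \<in> indets (row_op i j p)"
  then obtain \<nu> where \<nu>: "\<nu> \<in> Poly_Mapping.keys (derivation (row_var i j) p)"
    and v: "v \<in> Poly_Mapping.keys \<nu>"
    unfolding indets_def row_op_def by blast
  from \<nu> obtain \<mu> v' \<nu>' where *: "\<mu> \<in> Poly_Mapping.keys p" "v' \<in> Poly_Mapping.keys \<mu>"
    "\<nu>' \<in> Poly_Mapping.keys (row_var i j v')" "\<nu> = (\<mu> - sng v') + \<nu>'"
    by (rule keys_derivation)
  have "v \<in> Poly_Mapping.keys (\<mu> - sng v') \<or> v \<in> Poly_Mapping.keys \<nu>'"
    using v Poly_Mapping.keys_add[of "\<mu> - sng v'" \<nu>'] unfolding *(4) by blast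
  then show "v \<in> generic_vars n"
  proof
    assume "v \<in> Poly_Mapping.keys (\<mu> - sng v')"
    then have "v \<in> Poly_Mapping.keys \<mu>" by (auto simp: in_keys_iff lookup_minus)
    then show ?thesis using assms *(1) by (auto simp: indets_def)
  next
    assume "v \<in> Poly_Mapping.keys \<nu>'"
    then have v: "v \<in> indets (row_var i j v')" using *(3) by (auto simp: indets_def)
    have "v' \<in> generic_vars n" using assms *(1,2) by (auto simp: indets_def)
    then have "indets (row_var i j v') \<subseteq> generic_vars n"
    proof (cases v')
      case (Inl e)
      with \<open>v' \<in> generic_vars n\<close> show ?thesis by (cases e) (auto simp: Inl_generic_vars indets_0_1)
    next
      case (Inr q)
      then obtain r r' c c' where q: "v' = Inr ((r, r'), (c, c'))" by (metis surj_pair)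
      have "indets (bracket a b (c, c')) \<subseteq> generic_vars n" for a b
        using \<open>v' \<in> generic_vars n\<close> by (auto simp: q Inr_generic_vars indets_0_1 indets_uminus)
      then show ?thesis unfolding q row_var.simps
        by (intro indets_add_subset) (simp_all add: indets_0_1 del: bracket.simps)
    qed
    with v show ?thesis by blast
  qed
qed

lemma indets_restitute: "indets p \<subseteq> generic_vars n \<Longrightarrow> indets (P.restitute m \<sigma> xs p) \<subseteq> generic_vars n"
  by (induction xs) (simp_all add: P.restitute_Cons indets_row_op)

lemma relations_0: "0 \<in> relations n"
  by (simp add: relations_def indets_0_1 rees_map_def)

lemma relations_row_op: "p \<in> relations n \<Longrightarrow> row_op i j p \<in> relations n"
  by (simp add: relations_def indets_row_op rees_map_eq_0_iff rees_coeff_row_op row_op_S_simps)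

lemma relations_restitute: "p \<in> relations n \<Longrightarrow> P.restitute m \<sigma> xs p \<in> relations n"
  by (induction xs) (simp_all add: P.restitute_Cons relations_row_op)

lemma relations_polarize: "p \<in> relations n \<Longrightarrow> P.polarize m xs p \<in> relations n"
  by (induction xs) (simp_all add: P.polarize_Cons relations_row_op)

lemma relations_part:
  assumes "p \<in> relations n"
    and "\<And>\<mu> k \<nu>. \<nu> \<in> Poly_Mapping.keys (poly.coeff (rees_mon \<mu>) k) \<Longrightarrow> \<gamma> \<mu> = \<gamma>' \<nu> k"
  shows "part (\<lambda>\<mu>. \<gamma> \<mu> = g) p \<in> relations n"
  using assms rees_map_part[OF _ assms(2)] indets_mono[of "part (\<lambda>\<mu>. \<gamma> \<mu> = g) p" p]
  by (auto simp: relations_def keys_part)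

lemma fiber_ideal_0: "0 \<in> fiber_ideal n"
  by (rule fiber_ideal.generator[of _ _ 0 0]) (simp_all add: relations_0)

lemma fiber_ideal_const_mult: "p \<in> fiber_ideal n \<Longrightarrow> const c * p \<in> fiber_ideal n"
  by (rule fiber_ideal.mult) simp_all

lemma fiber_ideal_uminus: "p \<in> fiber_ideal n \<Longrightarrow> - p \<in> fiber_ideal n"
  using fiber_ideal.mult[of "- 1" n p] by (simp add: indets_0_1 indets_uminus)

lemma fiber_ideal_diff: "p \<in> fiber_ideal n \<Longrightarrow> q \<in> fiber_ideal n \<Longrightarrow> p - q \<in> fiber_ideal n"
  using fiber_ideal.add[OF _ fiber_ideal_uminus] by fastforce

lemma fiber_ideal_sum: "(\<And>a. a \<in> A \<Longrightarrow> f a \<in> fiber_ideal n) \<Longrightarrow> sum f A \<in> fiber_ideal n"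
  by (induction A rule: infinite_finite_induct) (simp_all add: fiber_ideal_0 fiber_ideal.add)

text \<open>Row operations keep both degrees and send relations to relations, so they take
  generators to generators; the Leibniz rule does the rest.\<close>

lemma fiber_ideal_row_op: "p \<in> fiber_ideal n \<Longrightarrow> row_op i j p \<in> fiber_ideal n"
proof (induction rule: fiber_ideal.induct)
  case (generator p d e)
  then show ?case
    using homog_row_op[of "\<lambda>_. 0" 1 0 "int d" p i j] homog_row_op[of "\<lambda>_. 0" 0 1 "int e" p i j]
    by (intro fiber_ideal.generator[of _ _ d e] relations_row_op) auto
next
  case (mult r p)
  then show ?case
    by (simp add: row_op_simps fiber_ideal.add fiber_ideal.mult indets_row_op)
qed (simp add: row_op_simps fiber_ideal.add)

section \<open>Comparison with finitely many rows\<close>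

lemma bidegree_eq: "bidegree \<mu> = (deg xdeg \<mu>, 2 * deg tdeg \<mu>)"
proof -
  let ?I = "{e. Inl e \<in> Poly_Mapping.keys \<mu>}" and ?K = "{q. Inr q \<in> Poly_Mapping.keys \<mu>}"
  have keys: "Poly_Mapping.keys \<mu> = Inl ` ?I \<union> Inr ` ?K"
  proof (rule Set.set_eqI)
    fix v show "v \<in> Poly_Mapping.keys \<mu> \<longleftrightarrow> v \<in> Inl ` ?I \<union> Inr ` ?K"
      by (cases v) auto
  qed
  have fin: "finite ?I" "finite ?K"
    using finite_vimageI[OF finite_keys[of \<mu>], of Inl] finite_vimageI[OF finite_keys[of \<mu>], of Inr]
    by (simp_all add: vimage_def)
  have "deg w \<mu> = (\<Sum>e\<in>?I. Poly_Mapping.lookup \<mu> (Inl e) * w (Inl e)) +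
      (\<Sum>q\<in>?K. Poly_Mapping.lookup \<mu> (Inr q) * w (Inr q))" for w
  proof -
    have "deg w \<mu> = (\<Sum>v\<in>Inl ` ?I \<union> Inr ` ?K. Poly_Mapping.lookup \<mu> v * w v)"
      by (rule deg_superset[OF _ equalityD1[OF keys]]) (simp add: fin)
    also have "\<dots> = (\<Sum>v\<in>Inl ` ?I. Poly_Mapping.lookup \<mu> v * w v) +
        (\<Sum>v\<in>Inr ` ?K. Poly_Mapping.lookup \<mu> v * w v)"
      by (rule sum.union_disjoint) (use fin in auto)
    finally show ?thesis by (simp add: sum.reindex)
  qed
  moreover have "xdeg (Inr q) = 0" "tdeg (Inr q) = 1" for q
    by (cases "(row_wt (\<lambda>_. 0), 0::nat, 0::nat, Inr q :: sr_var)" rule: wt.cases; simp)+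
  ultimately show ?thesis
    by (simp add: bidegree_def sum_distrib_left mult.commute split_beta)
qed

text \<open>\<open>homog (high m) 0 p\<close> encodes that \<open>p\<close> involves no row from
  \<open>m\<close> on, in a form to which the lemmas on homogeneous polynomials apply.\<close>

abbreviation high :: "nat \<Rightarrow> sr_var \<Rightarrow> nat"
  where "high m \<equiv> wt (row_wt (\<lambda>i. of_bool (m \<le> i))) 0 0"

lemma carrier_S_tensor_R: "carrier (S_tensor_R m n) = {p. indets p \<subseteq> generic_vars n \<and> homog (high m) 0 p}"
proof -
  have v: "v \<in> Inl ` entries m n \<union> Inr ` minor_indices m n \<longleftrightarrow> v \<in> generic_vars n \<and> high m v = 0" for v
    by (cases "(row_wt (\<lambda>_. 0), 0::nat, 0::nat, v)" rule: wt.cases)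
      (auto simp: Inl_generic_vars Inr_generic_vars entries_def minor_indices_def)
  have "homog (high m) 0 p \<longleftrightarrow> (\<forall>v\<in>indets p. high m v = 0)" for p
    by (auto simp: homog_def deg_eq_0_iff indets_def)
  moreover have "Inl ` entries m n \<union> Inr ` minor_indices m n = {v \<in> generic_vars n. high m v = 0}"
    by (rule Set.set_eqI) (simp only: v mem_Collect_eq)
  ultimately show ?thesis
    unfolding S_tensor_R_def poly_ring_def by auto
qed

lemma rees_ideal_eq: "rees_ideal m n = {p \<in> relations n. homog (high m) 0 p}"
  by (auto simp: rees_ideal_def carrier_S_tensor_R relations_def)

lemma ideal_poly_ringI:
  assumes sub: "I \<subseteq> carrier (poly_ring V)" and "0 \<in> I"
    and add: "\<And>p q. p \<in> I \<Longrightarrow> q \<in> I \<Longrightarrow> p + q \<in> I"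
    and mult: "\<And>r p. r \<in> carrier (poly_ring V) \<Longrightarrow> p \<in> I \<Longrightarrow> r * p \<in> I"
  shows "ideal I (poly_ring V)"
proof -
  interpret cring "poly_ring V" by (rule cring_poly_ring)
  have ops: "x \<otimes>\<^bsub>poly_ring V\<^esub> y = x * y" "x \<oplus>\<^bsub>poly_ring V\<^esub> y = x + y"
    "\<zero>\<^bsub>poly_ring V\<^esub> = 0" for x y
    by (simp_all add: poly_ring_def)
  have one: "- 1 \<in> carrier (poly_ring V)"
    by (simp add: poly_ring_def indets_uminus indets_0_1)
  show ?thesis
  proof (rule idealI)
    show "subgroup I (add_monoid (poly_ring V))"
    proof (rule group.subgroupI)
      show "Group.group (add_monoid (poly_ring V))" by (rule a_group)
      show "I \<noteq> {}" using \<open>0 \<in> I\<close> by blast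
      fix a b assume a: "a \<in> I"
      have "- a \<in> I" using mult[OF one a] by simp
      moreover have "\<ominus>\<^bsub>poly_ring V\<^esub> a = - a"
        using a sub \<open>- a \<in> I\<close> by (intro minus_equality) (auto simp: ops)
      ultimately show "inv\<^bsub>add_monoid (poly_ring V)\<^esub> a \<in> I" by (simp add: a_inv_def)
      assume "b \<in> I"
      then show "a \<otimes>\<^bsub>add_monoid (poly_ring V)\<^esub> b \<in> I"
        using add[OF a] ops by simp
    qed (use sub in auto)
  next
    fix a r assume "a \<in> I" "r \<in> carrier (poly_ring V)"
    then show "r \<otimes>\<^bsub>poly_ring V\<^esub> a \<in> I" "a \<otimes>\<^bsub>poly_ring V\<^esub> r \<in> I"
      using mult[of r a] by (simp_all add: ops mult.commute[of a r])
  qed (rule ring_axioms)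
qed

text \<open>Setting all rows from \<open>m\<close> on to zero maps \<open>fiber_ideal n\<close> into the ideal generated for
  \<open>m\<close> rows, so no relation of \<open>m\<close> rows needs generators with more rows.\<close>

lemma fiber_type_iff: "minors_ideal_fiber_type m n \<longleftrightarrow> rees_ideal m n \<subseteq> fiber_ideal n"
proof -
  define Gen where "Gen = (\<Union>d. rees_ideal_component m n (0, 2 * d)) \<union>
    (\<Union>d. rees_ideal_component m n (d, 2))"
  let ?R = "S_tensor_R m n"
  define I where "I = Idl\<^bsub>?R\<^esub> Gen"
  interpret cring ?R unfolding S_tensor_R_def by (rule cring_poly_ring)
  have Gen: "Gen \<subseteq> rees_ideal m n" by (auto simp: Gen_def rees_ideal_component_def)
  then have carr: "Gen \<subseteq> carrier ?R" by (auto simp: rees_ideal_def)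
  interpret I: ideal I ?R unfolding I_def by (rule genideal_ideal[OF carr])
  have Gen_I: "Gen \<subseteq> I" unfolding I_def by (rule genideal_self[OF carr])
  have ops: "x \<otimes>\<^bsub>?R\<^esub> y = x * y" "x \<oplus>\<^bsub>?R\<^esub> y = x + y" for x y
    by (simp_all add: S_tensor_R_def poly_ring_def)
  have I_rees: "I \<subseteq> rees_ideal m n"
    unfolding I_def by (rule genideal_minimal[OF ideal_rees_ideal Gen])
  have I_fiber: "I \<subseteq> fiber_ideal n"
  proof -
    have "ideal (fiber_ideal n \<inter> carrier ?R) ?R"
      unfolding S_tensor_R_def
    proof (rule ideal_poly_ringI, fold S_tensor_R_def)
      show "0 \<in> fiber_ideal n \<inter> carrier ?R"
        by (simp add: fiber_ideal_0 carrier_S_tensor_R indets_0_1)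
      show "p + q \<in> fiber_ideal n \<inter> carrier ?R"
        if "p \<in> fiber_ideal n \<inter> carrier ?R" "q \<in> fiber_ideal n \<inter> carrier ?R" for p q
        using that fiber_ideal.add[of p n q] a_closed[of p q] by (simp add: ops)
      show "r * p \<in> fiber_ideal n \<inter> carrier ?R"
        if "r \<in> carrier ?R" "p \<in> fiber_ideal n \<inter> carrier ?R" for r p
        using that fiber_ideal.mult[of r n p] m_closed[of r p] by (simp add: ops carrier_S_tensor_R)
    qed simp
    moreover have "Gen \<subseteq> fiber_ideal n \<inter> carrier ?R"
    proof
      fix p assume p: "p \<in> Gen"
      then obtain d e where de: "d = 0 \<or> e = 1" "\<forall>\<mu>\<in>Poly_Mapping.keys p. bidegree \<mu> = (d, 2 * e)"
      proof -
        consider d where "p \<in> rees_ideal_component m n (0, 2 * d)"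
          | d where "p \<in> rees_ideal_component m n (d, 2)"
          using p unfolding Gen_def by blast
        then show thesis
        proof cases
          case (1 d)
          then show ?thesis using that[of 0 d] by (auto simp: rees_ideal_component_def)
        next
          case (2 d)
          then show ?thesis using that[of d 1] by (auto simp: rees_ideal_component_def)
        qed
      qed
      then have "homog xdeg (int d) p" "homog tdeg (int e) p"
        by (auto simp: homog_def bidegree_eq)
      moreover have "p \<in> relations n" using p Gen by (auto simp: rees_ideal_eq)
      ultimately have "p \<in> fiber_ideal n" using de(1) by (blast intro: fiber_ideal.generator)
      then show "p \<in> fiber_ideal n \<inter> carrier ?R" using p carr by blast
    qed
    ultimately show ?thesis unfolding I_def using genideal_minimal by blast
  qed
  \<comment> \<open>The part free of the rows from \<open>m\<close> on. By
    \<open>part_deg_0_mult\<close> this projection is multiplicative, so it has to be followed on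
    generators only.\<close>
  let ?ret = "part (\<lambda>\<mu>. deg (high m) \<mu> = 0)"
  have ret_carrier: "?ret p \<in> carrier ?R" if "indets p \<subseteq> generic_vars n" for p
    using that indets_mono[of "?ret p" p] by (auto simp: carrier_S_tensor_R keys_part homog_def)
  have ret_I: "?ret p \<in> I" if "p \<in> fiber_ideal n" for p
    using that
  proof (induction rule: fiber_ideal.induct)
    case (generator p d e)
    have "?ret p \<in> relations n"
      by (rule relations_part[OF generator(1), where \<gamma>' = "\<lambda>\<nu> k. deg (row_wt (\<lambda>i. of_bool (m \<le> i))) \<nu>"])
        (use keys_rees_mon[where z = "row_wt (\<lambda>i. of_bool (m \<le> i))" and t = 0] in auto)
    then have "?ret p \<in> rees_ideal m n"
      by (auto simp: rees_ideal_eq keys_part homog_def)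
    moreover have "\<forall>\<mu>\<in>Poly_Mapping.keys (?ret p). bidegree \<mu> = (d, 2 * e)"
      using generator by (auto simp: keys_part homog_def bidegree_eq)
    ultimately have "?ret p \<in> Gen"
      using generator(4) by (auto simp: Gen_def rees_ideal_component_def)
    then show ?case using Gen_I by blast
  next
    case (add p q)
    then show ?case using I.a_closed[of "?ret p" "?ret q"] by (simp add: part_add ops)
  next
    case (mult r p)
    then show ?case
      using I.I_l_closed[OF mult.IH ret_carrier[OF mult(1)]] by (simp add: part_deg_0_mult ops)
  qed
  have "rees_ideal m n \<subseteq> I" if "rees_ideal m n \<subseteq> fiber_ideal n"
  proof
    fix p assume p: "p \<in> rees_ideal m n"
    then have "?ret p = p"
      by (intro part_eq_self) (auto simp: rees_ideal_eq homog_def)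
    then show "p \<in> I" using ret_I[of p] p that by auto
  qed
  then show ?thesis
    using I_rees I_fiber unfolding minors_ideal_fiber_type_def Gen_def[symmetric] I_def[symmetric]
    by blast
qed

section \<open>Alternating in more rows than columns\<close>

abbreviation csign :: "(nat \<Rightarrow> nat) \<Rightarrow> 'v cpoly"
  where "csign \<sigma> \<equiv> const (of_int (sign \<sigma>))"

lemma csign_compose_transpose:
  assumes "\<sigma> permutes {..<m}" "l \<noteq> l'"
  shows "csign (\<sigma> \<circ> transpose l l') = - csign \<sigma>"
proof -
  have "sign (\<sigma> \<circ> transpose l l') = - sign \<sigma>"
    using assms permutation_permutes
    by (subst sign_compose) (auto simp: permutation_swap_id sign_swap_id)
  then show ?thesis by (simp add: const_def single_uminus)
qed

lemma rees_coeff_const_mult: "rees_coeff k (const c * p) = const c * rees_coeff k p"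
  by (simp add: rees_coeff_def rees_map_mult rees_map_const)

lemma homog_pmon_iff: "homog w k (pmon \<mu>) \<longleftrightarrow> int (deg w \<mu>) = k"
  by (simp add: homog_def)

text \<open>By pigeonhole, two auxiliary rows \<open>m + l\<close> and \<open>m + l'\<close> have
  their entries of \<open>\<nu>\<close> in the same column. Composing \<open>\<sigma>\<close> with
  the transposition of \<open>l\<close> and \<open>l'\<close> then keeps the restituted monomial and
  flips the sign, so the sum equals its own negative. \<open>Q\<close> allows sums over permutations
  with a prescribed value outside \<open>xs\<close>.\<close>

lemma restitute_S_alternating_pmon:
  assumes xs: "distinct xs" "set xs \<subseteq> {..<m}" "n < length xs"
    and rows: "\<And>l. l \<in> set xs \<Longrightarrow> deg (row_wt (\<lambda>i. of_bool (i = m + l))) \<nu> = 1"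
    and cols: "\<And>r c. (r, c) \<in> Poly_Mapping.keys \<nu> \<Longrightarrow> c < n"
    and Q: "\<And>\<sigma> l l'. l \<in> set xs \<Longrightarrow> l' \<in> set xs \<Longrightarrow> Q (\<sigma> \<circ> transpose l l') = Q \<sigma>"
  shows "(\<Sum>\<sigma> | \<sigma> permutes {..<m} \<and> Q \<sigma>. csign \<sigma> * S.restitute m \<sigma> xs (pmon \<nu>)) = 0"
proof -
  let ?row = "\<lambda>l. row_wt (\<lambda>i. of_bool (i = m + l))"
  have "\<exists>c. (m + l, c) \<in> Poly_Mapping.keys \<nu>" if l: "l \<in> set xs" for l
  proof (rule ccontr)
    assume "\<not> ?thesis"
    then have "deg (?row l) \<nu> = 0" by (auto simp: deg_eq_0_iff)
    then show False using rows[OF l] by simp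
  qed
  then obtain c where c: "\<And>l. l \<in> set xs \<Longrightarrow> (m + l, c l) \<in> Poly_Mapping.keys \<nu>"
    by metis
  have "c ` set xs \<subseteq> {..<n}" using c cols by blast
  then have "card (c ` set xs) \<le> n" using card_mono[of "{..<n}" "c ` set xs"] by simp
  then have "\<not> inj_on c (set xs)"
    using xs distinct_card[OF xs(1)] by (intro pigeonhole) simp
  then obtain l l' where l: "l \<in> set xs" "l' \<in> set xs" "l \<noteq> l'" and cl: "c l' = c l"
    by (auto simp: inj_on_def)
  define \<nu>' where "\<nu>' = \<nu> - sng (m + l, c l) - sng (m + l', c l)"
  have "(m + l', c l) \<in> Poly_Mapping.keys (\<nu> - sng (m + l, c l))"
    using c[OF l(2)] l(3) cl by (auto simp: in_keys_iff lookup_minus lookup_sng)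
  then have \<nu>: "\<nu> = sng (m + l, c l) + (sng (m + l', c l) + \<nu>')"
    unfolding \<nu>'_def using sng_add_diff c[OF l(1)] by metis
  let ?ys = "remove1 l' (remove1 l xs)"
  \<comment> \<open>The two factors in front are exchanged by the transposition, and the rest
    depends on \<open>\<sigma>\<close> only through its values on \<open>?ys\<close>, where the
    transposition changes nothing.\<close>
  have restitute: "S.restitute m \<sigma> xs (pmon \<nu>) =
      var (\<sigma> l, c l) * (var (\<sigma> l', c l) * S.restitute m \<sigma> ?ys (pmon \<nu>'))"
    if \<sigma>: "\<sigma> permutes {..<m}" for \<sigma>
  proof -
    have less: "\<sigma> j < m" if "j \<in> set xs" for j
      using permutes_in_image[OF \<sigma>, of j] xs(2) that by auto
    have "S.restitute m \<sigma> xs (pmon \<nu>) = S.restitute m \<sigma> xs (var (m + l, c l) * (var (m + l', c l) * pmon \<nu>'))"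
      unfolding var_mult_pmon \<nu> by simp
    also have "\<dots> = var (\<sigma> l, c l) * S.restitute m \<sigma> (remove1 l xs) (var (m + l', c l) * pmon \<nu>')"
    proof (rule S.restitute_x_mult[OF l(1) less])
      show "row_op_S (\<sigma> l) (m + l) (var (m + l', c l) * pmon \<nu>') = 0"
        unfolding var_mult_pmon using rows[OF l(1)] l(3)
        by (intro row_op_S_eq_0) (simp add: homog_pmon_iff \<nu>)
    qed
    also have "S.restitute m \<sigma> (remove1 l xs) (var (m + l', c l) * pmon \<nu>') =
        var (\<sigma> l', c l) * S.restitute m \<sigma> ?ys (pmon \<nu>')"
    proof (rule S.restitute_x_mult)
      show "l' \<in> set (remove1 l xs)" using l by (simp add: xs(1))
      show "\<sigma> j < m" if "j \<in> set (remove1 l xs)" for j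
        using that less by (simp add: xs(1))
      show "row_op_S (\<sigma> l') (m + l') (pmon \<nu>') = 0"
        using rows[OF l(2)] l(3) by (intro row_op_S_eq_0) (simp add: homog_pmon_iff \<nu>)
    qed
    finally show ?thesis .
  qed
  let ?A = "{\<sigma>. \<sigma> permutes {..<m} \<and> Q \<sigma>}" and ?t = "transpose l l'"
  let ?T = "\<lambda>\<sigma>. csign \<sigma> * S.restitute m \<sigma> xs (pmon \<nu>)"
  have t: "?t permutes {..<m}" using l xs(2) by (intro permutes_swap_id) auto
  have swap: "\<sigma> \<circ> ?t \<in> ?A" if "\<sigma> \<in> ?A" for \<sigma>
    using that permutes_compose[OF t] Q[OF l(1,2)] by simp
  have "?T (\<sigma> \<circ> ?t) = - ?T \<sigma>" if "\<sigma> \<in> ?A" for \<sigma>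
  proof -
    have \<sigma>: "\<sigma> permutes {..<m}" using that by simp
    have "S.restitute m (\<sigma> \<circ> ?t) ?ys (pmon \<nu>') = S.restitute m \<sigma> ?ys (pmon \<nu>')"
      using xs(1) by (intro S.restitute_cong) simp
    moreover have "\<sigma> \<circ> ?t permutes {..<m}" using swap[OF that] by simp
    moreover have "(csign (\<sigma> \<circ> ?t) :: entry cpoly) = - csign \<sigma>"
      by (rule csign_compose_transpose[OF \<sigma> l(3)])
    ultimately show ?thesis
      using restitute[OF \<sigma>] restitute[of "\<sigma> \<circ> ?t"] by (simp add: mult_ac)
  qed
  then have "sum ?T ?A = (\<Sum>\<sigma>\<in>?A. - ?T (\<sigma> \<circ> ?t))"
    by (intro sum.cong) simp_all
  also have "\<dots> = - (\<Sum>\<sigma>\<in>?A. ?T (\<sigma> \<circ> ?t))" by (rule sum_negf)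
  also have "(\<Sum>\<sigma>\<in>?A. ?T (\<sigma> \<circ> ?t)) = sum ?T ?A"
    by (rule sum.reindex_bij_witness[where i = "\<lambda>\<sigma>. \<sigma> \<circ> ?t" and j = "\<lambda>\<sigma>. \<sigma> \<circ> ?t"])
      (use swap in \<open>auto simp: comp_assoc\<close>)
  finally show ?thesis by (rule cpoly_eq_neg_imp_zero)
qed

text \<open>Restitution commutes with \<Pi>, so it may be applied to the monomials of the image of
  \<open>g\<close>. By \<open>keys_rees_mon\<close> these inherit linearity in each auxiliary row
  and the restriction to \<open>n\<close> columns, hence the alternating sum of each
  vanishes.\<close>

lemma restitute_alternating_in_relations:
  assumes xs: "distinct xs" "set xs \<subseteq> {..<m}" "n < length xs"
    and g: "indets g \<subseteq> generic_vars n" "\<And>l. l \<in> set xs \<Longrightarrow> homog (rdeg (m + l)) 1 g"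
    and Q: "\<And>\<sigma> l l'. l \<in> set xs \<Longrightarrow> l' \<in> set xs \<Longrightarrow> Q (\<sigma> \<circ> transpose l l') = Q \<sigma>"
  shows "(\<Sum>\<sigma> | \<sigma> permutes {..<m} \<and> Q \<sigma>. csign \<sigma> * P.restitute m \<sigma> xs g) \<in> relations n"
proof -
  let ?A = "{\<sigma>. \<sigma> permutes {..<m} \<and> Q \<sigma>}"
  have "rees_coeff k (\<Sum>\<sigma>\<in>?A. csign \<sigma> * P.restitute m \<sigma> xs g) = 0" for k
  proof -
    let ?h = "rees_coeff k g"
    let ?c = "\<lambda>\<nu>. const (Poly_Mapping.lookup ?h \<nu>)"
    have S_const: "S.restitute m \<sigma> xs (const c * p) = const c * S.restitute m \<sigma> xs p" for \<sigma> c p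
      by (rule S.restitute_mult_left) simp
    have Fh: "S.restitute m \<sigma> xs ?h = (\<Sum>\<nu>\<in>Poly_Mapping.keys ?h. ?c \<nu> * S.restitute m \<sigma> xs (pmon \<nu>))" for \<sigma>
      by (subst cpoly_eq_sum[of ?h]) (simp only: S.restitute_sum S_const)
    have "rees_coeff k (\<Sum>\<sigma>\<in>?A. csign \<sigma> * P.restitute m \<sigma> xs g) = (\<Sum>\<sigma>\<in>?A. csign \<sigma> * S.restitute m \<sigma> xs ?h)"
      by (simp add: rees_coeff_sum rees_coeff_const_mult rees_coeff_restitute)
    also have "\<dots> = (\<Sum>\<sigma>\<in>?A. \<Sum>\<nu>\<in>Poly_Mapping.keys ?h. ?c \<nu> * (csign \<sigma> * S.restitute m \<sigma> xs (pmon \<nu>)))"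
      by (simp only: Fh sum_distrib_left mult.left_commute)
    also have "\<dots> = (\<Sum>\<nu>\<in>Poly_Mapping.keys ?h. ?c \<nu> * (\<Sum>\<sigma>\<in>?A. csign \<sigma> * S.restitute m \<sigma> xs (pmon \<nu>)))"
      by (subst sum.swap) (simp add: sum_distrib_left)
    also have "\<dots> = 0"
    proof (rule sum.neutral, rule ballI)
      fix \<nu> assume "\<nu> \<in> Poly_Mapping.keys ?h"
      then obtain \<mu> where \<mu>: "\<mu> \<in> Poly_Mapping.keys g"
        and \<nu>: "\<nu> \<in> Poly_Mapping.keys (poly.coeff (rees_mon \<mu>) k)"
        by (rule keys_rees_coeff)
      have "(\<Sum>\<sigma>\<in>?A. csign \<sigma> * S.restitute m \<sigma> xs (pmon \<nu>)) = 0"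
      proof (rule restitute_S_alternating_pmon[OF xs _ _ Q])
        show "deg (row_wt (\<lambda>i. of_bool (i = m + l))) \<nu> = 1" if "l \<in> set xs" for l
          using homogD[OF g(2)[OF that] \<mu>]
            keys_rees_mon[OF \<nu>, of "row_wt (\<lambda>i. of_bool (i = m + l))" 0] by simp
        \<comment> \<open>Counts the entries in forbidden columns; this weight is 0 on
          \<open>g\<close>, hence on \<open>\<nu>\<close>.\<close>
        let ?z = "\<lambda>(r :: nat, c). of_bool (n \<le> c) :: nat"
        have "wt ?z 0 0 v = 0" if "v \<in> generic_vars n" for v
          using that by (cases "(row_wt (\<lambda>_. 0), 0::nat, 0::nat, v)" rule: wt.cases)
            (auto simp: Inl_generic_vars Inr_generic_vars)
        then have "deg (wt ?z 0 0) \<mu> = 0"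
          using g(1) \<mu> by (auto simp: deg_eq_0_iff indets_def)
        then have "deg ?z \<nu> = 0"
          using keys_rees_mon[OF \<nu>, of ?z 0] by simp
        then show "c < n" if "(r, c) \<in> Poly_Mapping.keys \<nu>" for r c
          using that by (fastforce simp: deg_eq_0_iff)
      qed
      then show "?c \<nu> * (\<Sum>\<sigma>\<in>?A. csign \<sigma> * S.restitute m \<sigma> xs (pmon \<nu>)) = 0" by simp
    qed
    finally show ?thesis .
  qed
  moreover have "indets (\<Sum>\<sigma>\<in>?A. csign \<sigma> * P.restitute m \<sigma> xs g) \<subseteq> generic_vars n"
    by (intro indets_sum_subset indets_mult_subset indets_restitute g) simp
  ultimately show ?thesis by (simp add: relations_def rees_map_eq_0_iff)
qed

lemma homog_const_mult: "homog w k p \<Longrightarrow> homog w k (const c * p)"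
  by (auto simp: homog_def in_keys_iff lookup_const_mult)

lemma homog_sum: "(\<And>a. a \<in> A \<Longrightarrow> homog w k (f a)) \<Longrightarrow> homog w k (sum f A)"
  by (induction A rule: infinite_finite_induct) (simp_all add: homog_add)

lemma homog_xdeg_restitute: "homog xdeg k p \<Longrightarrow> homog xdeg k (P.restitute m \<sigma> xs p)"
  using homog_restitute[of "\<lambda>_. 0" 1 0 k p \<sigma> m xs] by simp

text \<open>The degree in the entries is reduced from \<open>Suc d\<close> to \<open>d\<close>:
  removing an entry from a monomial costs at most one of the \<open>m\<close> alternating rows, so
  at least \<open>n + 1\<close> remain and the cofactors are relations.\<close>

lemma restitute_alternating_in_fiber_ideal:
  assumes IH: "\<And>p. p \<in> relations n \<Longrightarrow> homog xdeg (int d) p \<Longrightarrow> p \<in> fiber_ideal n"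
    and m: "n + 2 \<le> m"
    and f: "indets f \<subseteq> generic_vars n" "homog xdeg (int (Suc d)) f"
      "\<And>l. l < m \<Longrightarrow> homog (rdeg (m + l)) 1 f"
  shows "(\<Sum>\<sigma> | \<sigma> permutes {..<m}. csign \<sigma> * P.restitute m \<sigma> [0..<m] f) \<in> fiber_ideal n"
proof -
  let ?A = "{\<sigma>. \<sigma> permutes {..<m}}"
  have mono: "(\<Sum>\<sigma>\<in>?A. csign \<sigma> * P.restitute m \<sigma> [0..<m] (pmon \<mu>)) \<in> fiber_ideal n"
    if \<mu>: "\<mu> \<in> Poly_Mapping.keys f" for \<mu>
  proof -
    have "deg xdeg \<mu> \<noteq> 0" using homogD[OF f(2) \<mu>] by simp
    then obtain v where v: "v \<in> Poly_Mapping.keys \<mu>" "xdeg v \<noteq> 0"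
      by (auto simp: deg_eq_0_iff)
    then obtain r c where rc: "v = Inl (r, c)"
      by (cases "(row_wt (\<lambda>_. 0), 0::nat, 0::nat, v)" rule: wt.cases) auto
    define g :: "sr_var cpoly" where "g = pmon (\<mu> - sng v)"
    have \<mu>_eq: "pmon \<mu> = var (Inl (r, c)) * g"
      unfolding g_def var_mult_pmon rc[symmetric] sng_add_diff[OF v(1)] ..
    have deg_g: "homog w (int (deg w \<mu>) - int (w v)) g" for w
      using deg_diff_sng[OF v(1), of w] by (simp add: g_def homog_pmon_iff)
    have val: "indets (pmon \<mu>) \<subseteq> generic_vars n" using indets_pmon[OF \<mu>] f(1) by blast
    have g_val: "indets g \<subseteq> generic_vars n"
      using indets_pmon_diff[of \<mu> "sng v"] val by (auto simp: g_def)
    have "v \<in> generic_vars n" using val v(1) by (auto simp: indets_def)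
    then have c: "c < n" by (simp add: rc Inl_generic_vars)
    have g_xdeg: "homog xdeg (int d) g"
      using deg_g[of xdeg] homogD[OF f(2) \<mu>] by (simp add: rc)
    have row: "homog (rdeg (m + l)) (1 - of_bool (r = m + l)) g" if "l < m" for l
      using deg_g[of "rdeg (m + l)"] homogD[OF f(3)[OF that] \<mu>] by (simp add: rc)
    show ?thesis
    proof (cases "m \<le> r \<and> r < m + m")
      \<comment> \<open>The removed entry lies in an auxiliary row \<open>m + j\<close>, and
        restitution turns it into an entry of row \<open>\<sigma> j\<close>.\<close>
      case True
      then obtain j where j: "r = m + j" "j < m"
        by (metis le_Suc_ex nat_add_left_cancel_less)
      let ?ys = "remove1 j [0..<m]"
      have "P.restitute m \<sigma> [0..<m] (pmon \<mu>) = var (Inl (\<sigma> j, c)) * P.restitute m \<sigma> ?ys g" if "\<sigma> \<in> ?A" for \<sigma>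
        unfolding \<mu>_eq j(1)
      proof (rule P.restitute_x_mult)
        show "\<sigma> l < m" if "l \<in> set [0..<m]" for l
          using permutes_in_image[of \<sigma> "{..<m}" l] that \<open>\<sigma> \<in> ?A\<close> by auto
        show "row_op (\<sigma> j) (m + j) g = 0"
          using row[OF j(2)] j(1) by (intro row_op_eq_0) simp
      qed (simp add: j(2))
      then have "(\<Sum>\<sigma>\<in>?A. csign \<sigma> * P.restitute m \<sigma> [0..<m] (pmon \<mu>)) =
          (\<Sum>\<sigma>\<in>?A. var (Inl (\<sigma> j, c)) * (csign \<sigma> * P.restitute m \<sigma> ?ys g))"
        by (intro sum.cong refl) (simp add: mult_ac)
      \<comment> \<open>Permutations are grouped by the value \<open>b\<close> of
        \<open>\<sigma> j\<close>. The entry is a constant factor of each group, and the cofactor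
        still alternates in the rows other than \<open>j\<close>.\<close>
      also have "\<dots> = (\<Sum>b<m. \<Sum>\<sigma> | \<sigma> \<in> ?A \<and> \<sigma> j = b.
          var (Inl (\<sigma> j, c)) * (csign \<sigma> * P.restitute m \<sigma> ?ys g))"
        by (rule sum.group[symmetric])
          (use permutes_in_image[of _ "{..<m}" j] j(2) finite_permutations[of "{..<m}"] in auto)
      also have "\<dots> = (\<Sum>b<m. var (Inl (b, c)) *
          (\<Sum>\<sigma> | \<sigma> permutes {..<m} \<and> \<sigma> j = b. csign \<sigma> * P.restitute m \<sigma> ?ys g))"
        by (simp add: sum_distrib_left)
      also have "\<dots> \<in> fiber_ideal n"
      proof (rule fiber_ideal_sum, rule fiber_ideal.mult[OF _ IH])
        fix b
        show "indets (var (Inl (b, c))) \<subseteq> generic_vars n" using c by (simp add: Inl_generic_vars)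
        show "(\<Sum>\<sigma> | \<sigma> permutes {..<m} \<and> \<sigma> j = b. csign \<sigma> * P.restitute m \<sigma> ?ys g) \<in> relations n"
        proof (rule restitute_alternating_in_relations)
          show "n < length ?ys" using j(2) m by (simp add: length_remove1)
          show "homog (rdeg (m + l)) 1 g" if "l \<in> set ?ys" for l
            using row[of l] that j(1) by auto
          show "((\<sigma> \<circ> transpose l l') j = b) = (\<sigma> j = b)" if "l \<in> set ?ys" "l' \<in> set ?ys" for \<sigma> l l'
            using that by (auto simp: transpose_def)
        qed (use g_val in auto)
        show "homog xdeg (int d) (\<Sum>\<sigma> | \<sigma> permutes {..<m} \<and> \<sigma> j = b. csign \<sigma> * P.restitute m \<sigma> ?ys g)"
          by (intro homog_sum homog_const_mult homog_xdeg_restitute g_xdeg)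
      qed
      finally show ?thesis .
    next
      \<comment> \<open>Restitution does not touch the row of the entry, and all \<open>m\<close>
        rows still alternate.\<close>
      case False
      have "P.restitute m \<sigma> [0..<m] (pmon \<mu>) = var (Inl (r, c)) * P.restitute m \<sigma> [0..<m] g" for \<sigma>
        unfolding \<mu>_eq using False by (intro P.restitute_mult_left) auto
      then have "(\<Sum>\<sigma>\<in>?A. csign \<sigma> * P.restitute m \<sigma> [0..<m] (pmon \<mu>)) =
          var (Inl (r, c)) * (\<Sum>\<sigma> | \<sigma> permutes {..<m} \<and> True. csign \<sigma> * P.restitute m \<sigma> [0..<m] g)"
        by (simp add: sum_distrib_left mult_ac)
      also have "\<dots> \<in> fiber_ideal n"
      proof (intro fiber_ideal.mult IH)
        show "indets (var (Inl (r, c))) \<subseteq> generic_vars n" using c by (simp add: Inl_generic_vars)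
        show "(\<Sum>\<sigma> | \<sigma> permutes {..<m} \<and> True. csign \<sigma> * P.restitute m \<sigma> [0..<m] g) \<in> relations n"
        proof (rule restitute_alternating_in_relations)
          show "homog (rdeg (m + l)) 1 g" if "l \<in> set [0..<m]" for l
            using row[of l] that False by auto
        qed (use g_val m in auto)
        show "homog xdeg (int d) (\<Sum>\<sigma> | \<sigma> permutes {..<m} \<and> True. csign \<sigma> * P.restitute m \<sigma> [0..<m] g)"
          by (intro homog_sum homog_const_mult homog_xdeg_restitute g_xdeg)
      qed
      finally show ?thesis .
    qed
  qed
  let ?c = "\<lambda>\<mu>. const (Poly_Mapping.lookup f \<mu>)"
  have P_const: "P.restitute m \<sigma> xs (const c * p) = const c * P.restitute m \<sigma> xs p" for \<sigma> xs c p
    by (rule P.restitute_mult_left) simp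
  have Ff: "P.restitute m \<sigma> xs f = (\<Sum>\<mu>\<in>Poly_Mapping.keys f. ?c \<mu> * P.restitute m \<sigma> xs (pmon \<mu>))" for \<sigma> xs
    by (subst cpoly_eq_sum[of f]) (simp only: P.restitute_sum P_const)
  have "(\<Sum>\<sigma>\<in>?A. csign \<sigma> * P.restitute m \<sigma> [0..<m] f) =
      (\<Sum>\<sigma>\<in>?A. \<Sum>\<mu>\<in>Poly_Mapping.keys f. ?c \<mu> * (csign \<sigma> * P.restitute m \<sigma> [0..<m] (pmon \<mu>)))"
    by (simp only: Ff sum_distrib_left mult.left_commute)
  also have "\<dots> = (\<Sum>\<mu>\<in>Poly_Mapping.keys f. ?c \<mu> * (\<Sum>\<sigma>\<in>?A. csign \<sigma> * P.restitute m \<sigma> [0..<m] (pmon \<mu>)))"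
    by (subst sum.swap) (simp add: sum_distrib_left)
  also have "\<dots> \<in> fiber_ideal n"
    by (intro fiber_ideal_sum fiber_ideal_const_mult mono)
  finally show ?thesis .
qed

section \<open>The Capelli recursion\<close>

lemma homog_rdeg_row_op:
  assumes "homog (rdeg r) k p" "i \<noteq> r" "j \<noteq> r"
  shows "homog (rdeg r) k (row_op i j p)"
  using homog_row_op[OF assms(1), of i j] assms(2,3) by simp

lemma homog_rdeg_restitute:
  assumes "homog (rdeg r) k p" "\<And>j. j \<in> set xs \<Longrightarrow> \<sigma> j \<noteq> r \<and> m + j \<noteq> r"
  shows "homog (rdeg r) k (P.restitute m \<sigma> xs p)"
  using assms(2) by (induction xs) (auto simp: P.restitute_Cons assms(1) intro!: homog_rdeg_row_op)

lemma homog_rdeg_polarize: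
  assumes "homog (rdeg r) k p" "\<And>j. j \<in> set xs \<Longrightarrow> j \<noteq> r \<and> m + j \<noteq> r"
  shows "homog (rdeg r) k (P.polarize m xs p)"
  using assms(2) by (induction xs) (auto simp: P.polarize_Cons assms(1) intro!: homog_rdeg_row_op)

text \<open>Row \<open>j\<close> passes through row \<open>m + j\<close> to row
  \<open>\<sigma> j\<close>, so the weight of the auxiliary row cancels.\<close>

lemma homog_restitute_polarize:
  assumes "homog (wt (row_wt u) s t) k p"
  shows "homog (wt (row_wt u) s t) (k + (\<Sum>j\<leftarrow>xs. int (u (\<sigma> j)) - int (u j)))
    (P.restitute m \<sigma> xs (P.polarize m xs p))"
proof -
  have "(\<Sum>j\<leftarrow>xs. int (u (m + j)) - int (u j)) + (\<Sum>j\<leftarrow>xs. int (u (\<sigma> j)) - int (u (m + j))) =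
      (\<Sum>j\<leftarrow>xs. int (u (\<sigma> j)) - int (u j))"
    by (simp flip: sum_list_addf)
  then show ?thesis
    using homog_restitute[OF homog_polarize[OF assms, of m xs], of \<sigma> m xs] by (simp add: add.assoc)
qed

text \<open>Euler's identity for the degree in row \<open>k\<close>. The restriction to
  \<open>generic_vars\<close> matters: on a minor symbol with rows out of order
  \<open>row_op k k\<close> can change the sign.\<close>

lemma row_op_euler:
  assumes "indets p \<subseteq> generic_vars n" "homog (rdeg k) (int a) p"
  shows "row_op k k p = of_nat a * p"
  unfolding row_op_def
proof (rule derivation_euler[OF assms(2)])
  fix \<mu> v assume "\<mu> \<in> Poly_Mapping.keys p" "v \<in> Poly_Mapping.keys \<mu>"
  then have "v \<in> generic_vars n" using assms(1) by (auto simp: indets_def)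
  then show "row_var k k v = of_nat (rdeg k v) * var v"
    by (cases "(row_wt (\<lambda>_. 0), 0::nat, 0::nat, v)" rule: wt.cases) (auto simp: Inr_generic_vars)
qed

lemma rows_high:
  assumes "homog (high m) 0 p"
  shows "homog (rdeg (m + j)) 0 p"
  unfolding homog_def
proof
  fix \<mu> assume "\<mu> \<in> Poly_Mapping.keys p"
  then have "high m v = 0" if "v \<in> Poly_Mapping.keys \<mu>" for v
    using homogD[OF assms] that by (auto simp: deg_eq_0_iff)
  moreover have "rdeg (m + j) v = 0" if "high m v = 0" for v
    using that by (cases "(row_wt (\<lambda>_. 0), 0::nat, 0::nat, v)" rule: wt.cases) auto
  ultimately show "int (deg (rdeg (m + j)) \<mu>) = 0"
    by (simp add: deg_eq_0_iff)
qed

text \<open>Row operations that replace a row by an earlier one, and so raise the weight, lower the moment.\<close>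

abbreviation moment :: "sr_var \<Rightarrow> nat"
  where "moment \<equiv> wt (row_wt (\<lambda>i. i)) 0 0"

text \<open>The Capelli operator for the rows in \<open>xs\<close>, applied to \<open>f\<close>: the
  full operator for \<open>[0..<m]\<close>, and \<open>f\<close> itself for the empty list.\<close>

definition capelli :: "nat \<Rightarrow> sr_var cpoly \<Rightarrow> nat list \<Rightarrow> sr_var cpoly"
  where "capelli m f xs = (\<Sum>\<sigma> | \<sigma> permutes set xs. csign \<sigma> * P.restitute m \<sigma> xs (P.polarize m xs f))"

context
  fixes n m d s :: nat and f :: "sr_var cpoly" and a :: "nat \<Rightarrow> nat"
  assumes f_relations: "f \<in> relations n" and f_high: "homog (high m) 0 f"
    and f_xdeg: "homog xdeg (int d) f" and f_moment: "homog moment (int s) f"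
    and f_rows: "\<And>r. homog (rdeg r) (int (a r)) f"
    \<comment> \<open>The induction hypothesis on the moment; the bound on the rows and the degree
      in the entries stay the same.\<close>
    and lower: "\<And>g s'. g \<in> relations n \<Longrightarrow> homog (high m) 0 g \<Longrightarrow> homog xdeg (int d) g \<Longrightarrow>
      homog moment (int s') g \<Longrightarrow> s' < s \<Longrightarrow> g \<in> fiber_ideal n"
begin

lemma lower_moment_mem:
  assumes "\<And>j. j \<in> set xs \<Longrightarrow> j < m \<and> \<sigma> j < m"
    and "(\<Sum>j\<leftarrow>xs. int (\<sigma> j) - int j) < 0"
  shows "P.restitute m \<sigma> xs (P.polarize m xs f) \<in> fiber_ideal n"
proof -
  let ?g = "P.restitute m \<sigma> xs (P.polarize m xs f)"
  have moment: "homog moment (int s + (\<Sum>j\<leftarrow>xs. int (\<sigma> j) - int j)) ?g"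
    by (rule homog_restitute_polarize[OF f_moment])
  show ?thesis
  proof (cases "?g = 0")
    case True
    then show ?thesis by (simp add: fiber_ideal_0)
  next
    \<comment> \<open>A monomial of \<open>?g\<close> shows that the shifted moment, a priori an
      integer, is a natural number, as \<open>lower\<close> requires.\<close>
    case False
    then obtain \<mu> where "\<mu> \<in> Poly_Mapping.keys ?g" using keys_eq_empty by blast
    then have s': "int (deg moment \<mu>) = int s + (\<Sum>j\<leftarrow>xs. int (\<sigma> j) - int j)"
      by (rule homogD[OF moment])
    have "map (\<lambda>j. int (of_bool (m \<le> \<sigma> j)) - int (of_bool (m \<le> j))) xs = map (\<lambda>_. 0) xs"
      using assms(1) by (intro map_cong refl) (force simp: not_le)
    then have "(\<Sum>j\<leftarrow>xs. int (of_bool (m \<le> \<sigma> j)) - int (of_bool (m \<le> j))) = 0"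
      by (simp only: sum_list_0)
    then have "homog (high m) 0 ?g"
      using homog_restitute_polarize[OF f_high, where \<sigma> = \<sigma> and xs = xs and m = m] by simp
    moreover have "homog xdeg (int d) ?g"
      using homog_restitute_polarize[OF f_xdeg, where \<sigma> = \<sigma> and xs = xs and m = m] by simp
    ultimately show ?thesis
      using s' assms(2) moment by (intro lower[of _ "deg moment \<mu>"])
        (auto intro: relations_restitute relations_polarize f_relations)
  qed
qed

text \<open>A permutation of \<open>k\<close> and \<open>ys\<close> is uniquely
  \<open>transpose k b \<circ> q\<close> with \<open>q\<close> permuting \<open>ys\<close>. For
  \<open>b = k\<close> the new operators act as multiplication by \<open>a k\<close>; each
  \<open>b\<close> in \<open>ys\<close> contributes, modulo the ideal, one further copy of
  \<open>capelli m f ys\<close>.\<close>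

lemma capelli_Cons:
  assumes ys: "distinct ys" "\<And>j. j \<in> set ys \<Longrightarrow> k < j \<and> j < m" and k: "k < m"
  shows "capelli m f (k # ys) - of_nat (a k + length ys) * capelli m f ys \<in> fiber_ideal n"
proof -
  let ?W = "\<lambda>\<sigma> xs. P.restitute m \<sigma> xs (P.polarize m xs f)"
  let ?\<sigma> = "\<lambda>b q. transpose k b \<circ> q"
  let ?A = "{q. q permutes set ys}"
  have k_ys: "k \<notin> set ys" using ys(2) by blast
  have zero: "homog (rdeg (m + k)) 0 (P.restitute m \<sigma> xs (P.polarize m ys f))"
    if "set xs \<subseteq> set ys" "\<And>j. j \<in> set xs \<Longrightarrow> \<sigma> j < m" for \<sigma> xs
    using that ys(2) k_ys
    by (intro homog_rdeg_restitute homog_rdeg_polarize rows_high f_high) fastforce+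
  have fixed: "?W q (k # ys) = of_nat (a k) * ?W q ys" if q: "q permutes set ys" for q
  proof -
    have qj: "q j < m" "q j \<noteq> k" if "j \<in> set ys" for j
      using permutes_in_image[OF q, of j] ys(2)[of "q j"] that by auto
    have "?W q (k # ys) = row_op k k (?W q ys)"
    proof (rule P.capelli_fixed[OF k _ k_ys qj(2) refl])
      show "q k = k" using permutes_not_in[OF q k_ys] .
      show "row_op k (m + k) (?W q ys) = 0" "row_op (m + k) (m + k) (?W q ys) = 0"
        by (intro row_op_eq_0 zero order_refl qj(1); simp)+
    qed
    also have "\<dots> = of_nat (a k) * ?W q ys"
    proof (rule row_op_euler)
      show "indets (?W q ys) \<subseteq> generic_vars n"
        using relations_restitute[OF relations_polarize[OF f_relations]] by (auto simp: relations_def)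
      show "homog (rdeg k) (int (a k)) (?W q ys)"
        using k k_ys qj by (intro homog_rdeg_restitute homog_rdeg_polarize f_rows) auto
    qed
    finally show ?thesis .
  qed
  \<comment> \<open>By \<open>capelli_moved\<close> the new term is \<open>row_op b k\<close> of a
    relation of smaller moment, which the ideal absorbs, minus the term of \<open>q\<close>. This
    minus sign cancels the sign of the transposition.\<close>
  have moved: "?W (?\<sigma> b q) (k # ys) + ?W q ys \<in> fiber_ideal n"
    if q: "q permutes set ys" and b: "b \<in> set ys" for q b
  proof -
    let ?s = "?\<sigma> b q"
    obtain l where qlb: "q l = b" using permutes_surj[OF q] by (metis surj_def)
    have ql: "q j = b \<longleftrightarrow> j = l" for j
      using permutes_inj[OF q] qlb by (auto dest: injD)
    have l: "l \<in> set ys" using permutes_in_image[OF q, of l] qlb b by simp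
    have qk: "q k = k" using permutes_not_in[OF q k_ys] .
    have q_ys: "q j \<in> set ys" if "j \<in> set ys" for j
      using permutes_in_image[OF q] that by blast
    have bk: "b \<noteq> k" "k < b" "b < m" using b k_ys ys(2) by auto
    have sk: "?s k = b" by (simp add: qk)
    have sm: "?s j < m" if "j \<in> set ys" for j
      using q_ys[OF that] ys(2)[of "q j"] bk k by (auto simp: transpose_def)
    have s_other: "?s j = q j" if "j \<in> set ys" "j \<noteq> l" for j
      using q_ys[OF that(1)] that(2) ql k_ys by (auto simp: transpose_def)
    let ?Y = "P.restitute m ?s (remove1 l ys) (P.polarize m ys f)"
    have Y0: "homog (rdeg (m + k)) 0 ?Y"
      using sm set_remove1_subset[of l ys] by (intro zero) auto
    have "?W ?s (k # ys) = row_op (?s k) k (?W ?s ys) - row_op (?s k) (m + l) ?Y"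
    proof (rule P.capelli_moved[OF k k_ys _ _ ys(1) sm l _ refl])
      show "?s k \<noteq> k" "?s k < m" using sk bk by simp_all
      show "(?s j = k) = (j = l)" if "j \<in> set ys" for j
        using q_ys[OF that] ql k_ys by (auto simp: transpose_def)
      show "row_op (?s k) (m + k) ?Y = 0" by (rule row_op_eq_0[OF Y0])
      show "row_op (?s k) (m + k) (row_op k (m + l) ?Y) = 0"
        using k l k_ys by (intro row_op_eq_0 homog_rdeg_row_op Y0) auto
    qed
    \<comment> \<open>As \<open>?s k = b = q l\<close>, this operator is the one of \<open>l\<close>
      in the restitution by \<open>q\<close>; elsewhere on \<open>ys\<close> the maps
      \<open>?s\<close> and \<open>q\<close> agree.\<close>
    moreover have "row_op (?s k) (m + l) ?Y = ?W q ys"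
    proof -
      have "?Y = P.restitute m q (remove1 l ys) (P.polarize m ys f)"
        using ys(1) by (intro P.restitute_cong s_other) auto
      moreover have "?W q ys = row_op (q l) (m + l) (P.restitute m q (remove1 l ys) (P.polarize m ys f))"
        using l q_ys ys(2) by (intro P.restitute_remove1) auto
      ultimately show ?thesis using sk qlb by simp
    qed
    moreover have "?W ?s ys \<in> fiber_ideal n"
    proof (rule lower_moment_mem)
      show "j < m \<and> ?s j < m" if "j \<in> set ys" for j
        using sm[OF that] ys(2)[OF that] by blast
      \<comment> \<open>On \<open>ys\<close> alone, \<open>?s\<close> sends \<open>l\<close> to
        \<open>k\<close> and not to \<open>b\<close>, so the sum of its values is lower by
        \<open>b - k\<close>.\<close>
      have perm: "?s permutes insert k (set ys)"
        using q b by (intro permutes_compose[OF permutes_imp_permutes_insert] permutes_swap_id) auto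
      have "(\<Sum>j\<in>insert k (set ys). int (?s j)) = (\<Sum>j\<in>insert k (set ys). int j)"
        using sum.permute[OF perm, of int] by (simp add: comp_def)
      then have "(\<Sum>j\<in>set ys. int (?s j)) + int b = (\<Sum>j\<in>set ys. int j) + int k"
        using k_ys sk by simp
      then show "(\<Sum>j\<leftarrow>ys. int (?s j) - int j) < 0"
        using bk(2) by (simp add: sum_list_distinct_conv_sum_set ys(1) sum_subtractf)
    qed
    ultimately show ?thesis
      using fiber_ideal_row_op[of "?W ?s ys" n "?s k" k] by simp
  qed
  have sgn: "(csign (?\<sigma> b q) :: sr_var cpoly) = - csign q" if "q permutes set ys" "b \<in> set ys" for b q
  proof -
    have "sign (?\<sigma> b q) = - sign q"
      using that k_ys permutation_permutes
      by (subst sign_compose) (auto simp: permutation_swap_id sign_swap_id)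
    then show ?thesis by (simp add: const_def single_uminus)
  qed
  have "capelli m f (k # ys) =
      (\<Sum>b\<in>insert k (set ys). \<Sum>q\<in>?A. csign (?\<sigma> b q) * ?W (?\<sigma> b q) (k # ys))"
    unfolding capelli_def list.set by (rule sum_over_permutations_insert) (use k_ys in auto)
  also have "\<dots> = (\<Sum>q\<in>?A. csign q * ?W q (k # ys)) +
      (\<Sum>b\<in>set ys. \<Sum>q\<in>?A. csign (?\<sigma> b q) * ?W (?\<sigma> b q) (k # ys))"
    using k_ys by simp
  also have "(\<Sum>q\<in>?A. csign q * ?W q (k # ys)) = of_nat (a k) * capelli m f ys"
    by (simp add: capelli_def sum_distrib_left fixed mult_ac)
  also have "(\<Sum>b\<in>set ys. \<Sum>q\<in>?A. csign (?\<sigma> b q) * ?W (?\<sigma> b q) (k # ys)) =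
      (\<Sum>b\<in>set ys. \<Sum>q\<in>?A. csign q * ?W q ys - csign q * (?W (?\<sigma> b q) (k # ys) + ?W q ys))"
    by (intro sum.cong refl) (simp add: sgn algebra_simps)
  also have "\<dots> = of_nat (length ys) * capelli m f ys -
      (\<Sum>b\<in>set ys. \<Sum>q\<in>?A. csign q * (?W (?\<sigma> b q) (k # ys) + ?W q ys))"
    by (simp add: sum_subtractf capelli_def distinct_card[OF ys(1)])
  finally have "capelli m f (k # ys) - of_nat (a k + length ys) * capelli m f ys =
      - (\<Sum>b\<in>set ys. \<Sum>q\<in>?A. csign q * (?W (?\<sigma> b q) (k # ys) + ?W q ys))"
    by (simp add: algebra_simps)
  also have "\<dots> \<in> fiber_ideal n"
    by (intro fiber_ideal_uminus fiber_ideal_sum fiber_ideal_const_mult moved) auto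
  finally show ?thesis .
qed

text \<open>The recursion is run from \<open>[0..<m]\<close> down to the empty list, each time
  dividing by a nonzero number: the list after \<open>k\<close> is nonempty unless
  \<open>k = m - 1\<close>, and there \<open>a (m - 1)\<close> is positive.\<close>

lemma mem_if_capelli_mem:
  assumes "capelli m f [0..<m] \<in> fiber_ideal n" and "0 < m" "0 < a (m - 1)"
  shows "f \<in> fiber_ideal n"
proof -
  have "capelli m f [k..<m] \<in> fiber_ideal n" if "k \<le> m" for k
    using that
  proof (induction k)
    case 0
    show ?case by (rule assms(1))
  next
    case (Suc k)
    let ?N = "a k + length [Suc k..<m]"
    have "?N \<noteq> 0"
    proof (cases "Suc k = m")
      case True
      then have "k = m - 1" by simp
      then show ?thesis using assms(3) by simp
    next
      case False
      then show ?thesis using Suc.prems by simp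
    qed
    have up: "[k..<m] = k # [Suc k..<m]" using Suc.prems by (simp add: upt_conv_Cons)
    have "capelli m f (k # [Suc k..<m]) - of_nat ?N * capelli m f [Suc k..<m] \<in> fiber_ideal n"
      by (rule capelli_Cons) (use Suc.prems in auto)
    moreover have "capelli m f (k # [Suc k..<m]) \<in> fiber_ideal n"
      using Suc by (simp add: up)
    ultimately have "of_nat ?N * capelli m f [Suc k..<m] \<in> fiber_ideal n"
      using fiber_ideal_diff by fastforce
    then have "const (1 / of_nat ?N) * (of_nat ?N * capelli m f [Suc k..<m]) \<in> fiber_ideal n"
      by (rule fiber_ideal_const_mult)
    moreover have "const (1 / c) * const c = (1 :: sr_var cpoly)" if "c \<noteq> 0" for c
      using that by (simp flip: const_mult)
    then have "const (1 / of_nat ?N) * of_nat ?N = (1 :: sr_var cpoly)"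
      using \<open>?N \<noteq> 0\<close> by (metis const_def of_nat_eq_0_iff single_of_nat)
    ultimately show ?case by (simp only: mult.assoc[symmetric] mult_1_left)
  qed
  from this[of m] show ?thesis by (simp add: capelli_def)
qed

end


section \<open>The induction\<close>

text \<open>Serves to recover the degree in the entries: \<open>xdeg\<close> by itself cannot be
  read off from the image under \<Pi>, but the total degree and the degree in t can.\<close>

lemma deg_total: "deg (wt (row_wt (\<lambda>_. 1)) 0 0) \<mu> = deg xdeg \<mu> + 2 * deg tdeg \<mu>"
proof -
  have "wt (row_wt (\<lambda>_. 1)) 0 0 v = xdeg v + 2 * tdeg v" for v
    by (cases "(row_wt (\<lambda>_. 0), 0::nat, 0::nat, v)" rule: wt.cases) auto
  then show ?thesis
    unfolding deg_def sum_distrib_left sum.distrib[symmetric]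
    by (intro sum.cong refl) (simp only: algebra_simps)
qed

text \<open>\<Pi> is homogeneous for \<open>\<gamma>\<close>, so a relation is a sum of relations on
  which \<open>\<gamma>\<close> is constant; \<open>\<mu>\<^sub>0\<close> represents the constant
  value.\<close>

lemma mem_of_parts:
  assumes "p \<in> relations n"
    and \<gamma>: "\<And>\<mu> k \<nu>. \<nu> \<in> Poly_Mapping.keys (poly.coeff (rees_mon \<mu>) k) \<Longrightarrow> \<gamma> \<mu> = \<gamma>' \<nu> k"
    and "\<And>\<mu>\<^sub>0 q. q \<in> relations n \<Longrightarrow> Poly_Mapping.keys q \<subseteq> Poly_Mapping.keys p \<Longrightarrow>
      (\<And>\<mu>. \<mu> \<in> Poly_Mapping.keys q \<Longrightarrow> \<gamma> \<mu> = \<gamma> \<mu>\<^sub>0) \<Longrightarrow> q \<in> fiber_ideal n"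
  shows "p \<in> fiber_ideal n"
proof -
  let ?K = "\<gamma> ` Poly_Mapping.keys p"
  have "(\<Sum>g\<in>?K. part (\<lambda>\<mu>. \<gamma> \<mu> = g) p) \<in> fiber_ideal n"
  proof (rule fiber_ideal_sum)
    fix g assume "g \<in> ?K"
    then obtain \<mu>\<^sub>0 where "g = \<gamma> \<mu>\<^sub>0" by blast
    then show "part (\<lambda>\<mu>. \<gamma> \<mu> = g) p \<in> fiber_ideal n"
      by (intro assms(3)[of _ \<mu>\<^sub>0] relations_part[OF assms(1) \<gamma>]) (auto simp: keys_part)
  qed
  then show ?thesis by (simp add: sum_parts[of ?K \<gamma> p])
qed

lemma xdeg_Suc_mem:
  assumes base: "rees_ideal (n + 2) n \<subseteq> fiber_ideal n"
    and IH: "\<And>p. p \<in> relations n \<Longrightarrow> homog xdeg (int d) p \<Longrightarrow> p \<in> fiber_ideal n"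
    and "n + 2 \<le> m" "p \<in> relations n" "homog (high m) 0 p" "homog xdeg (int (Suc d)) p"
  shows "p \<in> fiber_ideal n"
  using assms(3-)
proof (induction m arbitrary: p rule: dec_induct)
  case base
  then show ?case using assms(1) by (auto simp: rees_ideal_eq)
next
  case (step m)
  let ?M = "Suc m"
  \<comment> \<open>Induction on the moment supplies \<open>lower\<close>; splitting by all row
    degrees at once supplies the function \<open>a\<close>.\<close>
  have *: "p \<in> fiber_ideal n"
    if "p \<in> relations n" "homog (high ?M) 0 p" "homog xdeg (int (Suc d)) p" "homog moment (int s) p" for p s
    using that
  proof (induction s arbitrary: p rule: less_induct)
    case (less s)
    show ?case
    proof (rule mem_of_parts[OF less.prems(1)])
      let ?\<gamma> = "\<lambda>\<mu> r. deg (rdeg r) \<mu>"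
      show "?\<gamma> \<mu> = (\<lambda>r. deg (row_wt (\<lambda>i. of_bool (i = r))) \<nu>)"
        if "\<nu> \<in> Poly_Mapping.keys (poly.coeff (rees_mon \<mu>) k)" for \<mu> k \<nu>
        using keys_rees_mon[OF that, of "row_wt (\<lambda>i. of_bool (i = r))" 0 for r] by auto
      fix \<mu>\<^sub>0 f
      assume f: "f \<in> relations n" "Poly_Mapping.keys f \<subseteq> Poly_Mapping.keys p"
        and \<gamma>: "\<And>\<mu>. \<mu> \<in> Poly_Mapping.keys f \<Longrightarrow> ?\<gamma> \<mu> = ?\<gamma> \<mu>\<^sub>0"
      define a where "a = ?\<gamma> \<mu>\<^sub>0"
      have rows: "homog (rdeg r) (int (a r)) f" for r
        using fun_cong[OF \<gamma>, of _ r] by (auto simp: homog_def a_def)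
      have high: "homog (high ?M) 0 f" and xdeg: "homog xdeg (int (Suc d)) f"
        and moment: "homog moment (int s) f"
        using less.prems homog_subset[OF _ f(2)] by blast+
      show "f \<in> fiber_ideal n"
      proof (cases "a m = 0")
        \<comment> \<open>The last row is absent from \<open>f\<close>, so the induction on the
          number of rows applies.\<close>
        case True
        have "homog (high m) 0 f"
          unfolding homog_def
        proof
          fix \<mu> assume \<mu>: "\<mu> \<in> Poly_Mapping.keys f"
          have "high m v = high ?M v + rdeg m v" for v
            by (cases "(row_wt (\<lambda>_. 0), 0::nat, 0::nat, v)" rule: wt.cases) auto
          then show "int (deg (high m) \<mu>) = 0"
            using homogD[OF high \<mu>] homogD[OF rows[of m] \<mu>] True by (simp add: deg_eq_0_iff)
        qed
        then show ?thesis using step.IH f(1) xdeg by blast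
      next
        case False
        show ?thesis
        proof (rule mem_if_capelli_mem[OF f(1) high xdeg moment rows])
          show "g \<in> fiber_ideal n"
            if "g \<in> relations n" "homog (high ?M) 0 g" "homog xdeg (int (Suc d)) g"
              "homog moment (int s') g" "s' < s" for g s'
            using less.IH that by blast
          \<comment> \<open>Polarizing once in each row makes \<open>?g\<close> linear in each
            auxiliary row, as \<open>f\<close> has degree 0 there.\<close>
          let ?g = "P.polarize ?M [0..<?M] f"
          have "(\<Sum>\<sigma> | \<sigma> permutes {..<?M}. csign \<sigma> * P.restitute ?M \<sigma> [0..<?M] ?g) \<in> fiber_ideal n"
          proof (rule restitute_alternating_in_fiber_ideal[OF IH])
            show "n + 2 \<le> ?M" using step.hyps by simp
            show "indets ?g \<subseteq> generic_vars n" using relations_polarize[OF f(1)] by (auto simp: relations_def)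
            show "homog xdeg (int (Suc d)) ?g"
              using homog_polarize[OF xdeg, where m = ?M and xs = "[0..<?M]"] by simp
            show "homog (rdeg (?M + l)) 1 ?g" if "l < ?M" for l
            proof -
              have "(\<Sum>j\<leftarrow>[0..<?M]. int (of_bool (?M + j = ?M + l)) - int (of_bool (j = ?M + l))) =
                  (\<Sum>j\<in>{0..<?M}. int (of_bool (j = l)))"
                unfolding sum_list_distinct_conv_sum_set[OF distinct_upt] set_upt
                by (intro sum.cong) auto
              also have "\<dots> = 1" using that by (subst sum.remove[of _ l]) auto
              finally show ?thesis
                using homog_polarize[OF rows_high[OF high, of l], where m = ?M and xs = "[0..<?M]"] by simp
            qed
          qed
          then show "capelli ?M f [0..<?M] \<in> fiber_ideal n"
            by (simp only: capelli_def set_upt atLeast0LessThan)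
        qed (use False in auto)
      qed
    qed
  qed
  show ?case
  proof (rule mem_of_parts[OF step.prems(1)])
    show "deg moment \<mu> = deg (row_wt (\<lambda>i. i)) \<nu>"
      if "\<nu> \<in> Poly_Mapping.keys (poly.coeff (rees_mon \<mu>) k)" for \<mu> k \<nu>
      using keys_rees_mon[OF that, of "row_wt (\<lambda>i. i)" 0] by auto
    fix \<mu>\<^sub>0 q
    assume q: "q \<in> relations n" "Poly_Mapping.keys q \<subseteq> Poly_Mapping.keys p"
      and "\<And>\<mu>. \<mu> \<in> Poly_Mapping.keys q \<Longrightarrow> deg moment \<mu> = deg moment \<mu>\<^sub>0"
    then have "homog moment (int (deg moment \<mu>\<^sub>0)) q" by (auto simp: homog_def)
    then show "q \<in> fiber_ideal n"
      by (rule *[OF q(1) homog_subset[OF step.prems(2) q(2)] homog_subset[OF step.prems(3) q(2)]])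
  qed
qed

lemma ex_high:
  assumes "p \<in> relations n"
  obtains m where "n + 2 \<le> m" "homog (high m) 0 p"
proof -
  have "\<exists>m. n + 2 \<le> m \<and> (\<forall>v\<in>V. high m v = 0)" if "finite V" for V
    using that
  proof (induction V)
    case (insert v V)
    then obtain m where m: "n + 2 \<le> m" "\<forall>v\<in>V. high m v = 0" by blast
    obtain m' where m': "high m' v = 0"
    proof (cases "(row_wt (\<lambda>_. 0), 0::nat, 0::nat, v)" rule: wt.cases)
      case (1 z s t e)
      then show ?thesis using that[of "Suc (fst e)"] by (cases e) auto
    next
      case (2 z s t r r' c c')
      then show ?thesis using that[of "Suc (r + r')"] by auto
    qed
    have mono: "high (max m m') u \<le> high k u" if "k \<le> max m m'" for u k
      using that by (cases "(row_wt (\<lambda>_. 0), 0::nat, 0::nat, u)" rule: wt.cases) auto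
    have "\<forall>u\<in>insert v V. high (max m m') u = 0"
      using m(2) m' mono[of m] mono[of m'] by (metis insert_iff le_zero_eq max.cobounded1 max.cobounded2)
    then show ?case using m(1) by (intro exI[of _ "max m m'"]) auto
  qed auto
  moreover have "finite (indets p)" by (simp add: indets_def)
  ultimately obtain m where "n + 2 \<le> m" "\<forall>v\<in>indets p. high m v = 0" by blast
  then show thesis by (intro that[of m]) (auto simp: homog_def deg_eq_0_iff indets_def)
qed

lemma relations_subset_fiber_ideal:
  assumes base: "rees_ideal (n + 2) n \<subseteq> fiber_ideal n"
  shows "relations n \<subseteq> fiber_ideal n"
proof
  have *: "p \<in> fiber_ideal n" if "p \<in> relations n" "homog xdeg (int d) p" for d p
    using that
  proof (induction d arbitrary: p)
    \<comment> \<open>A relation free of entries splits by \<open>tdeg\<close> into relations of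
      bi-degree (0, 2e), which are generators.\<close>
    case 0
    show ?case
    proof (rule mem_of_parts[OF 0(1)])
      show "deg tdeg \<mu> = k"
        if "\<nu> \<in> Poly_Mapping.keys (poly.coeff (rees_mon \<mu>) k)" for \<mu> k \<nu>
        using keys_rees_mon[OF that, of "row_wt (\<lambda>_. 0)" 1] by (auto simp: deg_eq_0_iff)
      fix \<mu>\<^sub>0 q
      assume q: "q \<in> relations n" "Poly_Mapping.keys q \<subseteq> Poly_Mapping.keys p"
        and "\<And>\<mu>. \<mu> \<in> Poly_Mapping.keys q \<Longrightarrow> deg tdeg \<mu> = deg tdeg \<mu>\<^sub>0"
      then have "homog tdeg (int (deg tdeg \<mu>\<^sub>0)) q" by (auto simp: homog_def)
      then show "q \<in> fiber_ideal n"
        using fiber_ideal.generator[OF q(1) homog_subset[OF 0(2) q(2)]] by blast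
    qed
  next
    case (Suc d)
    obtain m where "n + 2 \<le> m" "homog (high m) 0 p" using ex_high[OF Suc.prems(1)] .
    then show ?case using xdeg_Suc_mem[OF base Suc.IH] Suc.prems by blast
  qed
  fix p assume p: "p \<in> relations n"
  \<comment> \<open>Both components can be read off in S[t], and by \<open>deg_total\<close> they
    determine the degree in the entries.\<close>
  let ?\<gamma> = "\<lambda>\<mu>. (deg (wt (row_wt (\<lambda>_. 1)) 0 0) \<mu>, deg tdeg \<mu>)"
  show "p \<in> fiber_ideal n"
  proof (rule mem_of_parts[OF p])
    show "?\<gamma> \<mu> = (deg (row_wt (\<lambda>_. 1)) \<nu>, k)"
      if "\<nu> \<in> Poly_Mapping.keys (poly.coeff (rees_mon \<mu>) k)" for \<mu> k \<nu>
      using keys_rees_mon[OF that, of "row_wt (\<lambda>_. 1)" 0] keys_rees_mon[OF that, of "row_wt (\<lambda>_. 0)" 1]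
      by (auto simp: deg_eq_0_iff)
    fix \<mu>\<^sub>0 q
    assume q: "q \<in> relations n" and \<gamma>: "\<And>\<mu>. \<mu> \<in> Poly_Mapping.keys q \<Longrightarrow> ?\<gamma> \<mu> = ?\<gamma> \<mu>\<^sub>0"
    have "deg xdeg \<mu> = deg xdeg \<mu>\<^sub>0" if "\<mu> \<in> Poly_Mapping.keys q" for \<mu>
      using \<gamma>[OF that] unfolding deg_total prod.inject by linarith
    then have "homog xdeg (int (deg xdeg \<mu>\<^sub>0)) q"
      unfolding homog_def by (intro ballI arg_cong[where f = int])
    then show "q \<in> fiber_ideal n" using * q by blast
  qed
qed

theorem proposition7p2:
  fixes n :: nat
  assumes "n \<ge> 1"
    and "minors_ideal_fiber_type (n + 2) n"
  shows "\<forall>m\<ge>n. minors_ideal_fiber_type m n"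
  using assms(2) relations_subset_fiber_ideal by (auto simp: fiber_type_iff rees_ideal_eq)

end
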